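(* Let $\widetilde\Omega\subset\mathbb{C}$ be a domain enclosed by a smooth Jordan curve, containing $0$, with interior conformal mapping $\Phi[\widetilde\Omega](z)=b_1z+b_2z^2+b_3z^3+\cdots$, $b_1>0$, and let $\Omega=\left\{\frac1z:z\in\mathbb{C}\setminus\overline{\widetilde\Omega}\right\}\cup\{0\}$, with area $|\Omega|$. Then, for each choice of the sign $\pm$, $$\frac1{b_1^2}\pm\frac1{b_1^3}\operatorname{Re}\left(\frac{b_2^2}{b_1}-b_3\right)\ge\frac{|\Omega|}{2\pi}.$$ In particular, if $|\Omega|=1$, then $\frac1{b_1^2}\pm\frac1{b_1^3}\operatorname{Re}\left(\frac{b_2^2}{b_1}-b_3\right)\ge\frac1{2\pi}$. Further, suppose that $\widetilde V$ is another domain enclosed by a smooth Jordan curve satisfying $\widetilde\Omega\subseteq\widetilde V$, with interior conformal mapping $\Phi[\widetilde V](z)=c_1z+c_2z^2+c_3z^3+\cdots$, $c_1>0$. Then, for each choice of the sign $\pm$ (the same on both sides), $$\frac1{b_1^2}\pm\frac1{b_1^3}\operatorname{Re}\left(\frac{b_2^2}{b_1}-b_3\right)\ge\frac1{c_1^2}\pm\frac1{c_1^3}\operatorname{Re}\left(\frac{c_2^2}{c_1}-c_3\right).$$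
   Context: For a domain $\widetilde\Omega\subset\mathbb{C}$ enclosed by a Jordan curve and containing $0$, its interior conformal mapping $\Phi[\widetilde\Omega]$ is the unique conformal (bijective holomorphic) map from the open unit disk onto $\widetilde\Omega$ with $\Phi[\widetilde\Omega](0)=0$ and $\Phi[\widetilde\Omega]'(0)>0$; its Taylor coefficients are complex numbers, the first one being positive. *)

theory Defs
  imports "HOL-Complex_Analysis.Complex_Analysis"
begin

text \<open>
  \<open>D\<close> is the bounded component of the complement of a smooth Jordan curve. Smoothness is that of a
  closed curve, i.e. also across the base point, hence the parametrization is a 1-periodic function
  on all of \<open>\<real>\<close>; it is continuously differentiable with nowhere vanishing derivative.
\<close>

definition enclosed_by_smooth_Jordan_curve :: "complex set \<Rightarrow> bool" where
  "enclosed_by_smooth_Jordan_curve D \<longleftrightarrow>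
     (\<exists>g :: real \<Rightarrow> complex.
        simple_path g \<and> pathfinish g = pathstart g \<and>
        (\<forall>t. g (t + 1) = g t) \<and>
        g C1_differentiable_on UNIV \<and> (\<forall>t. vector_derivative g (at t) \<noteq> 0) \<and>
        D = inside (path_image g))"

definition interior_conformal_map :: "complex set \<Rightarrow> (complex \<Rightarrow> complex) \<Rightarrow> bool" where
  "interior_conformal_map D \<Phi> \<longleftrightarrow>
     \<Phi> holomorphic_on ball 0 1 \<and> bij_betw \<Phi> (ball 0 1) D \<and>
     \<Phi> 0 = 0 \<and> deriv \<Phi> 0 \<in> \<real> \<and> Re (deriv \<Phi> 0) > 0"

definition inverted_exterior :: "complex set \<Rightarrow> complex set" where
  "inverted_exterior D = {1 / z | z. z \<notin> closure D} \<union> {0}"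

end

theory Submission
  imports Defs
begin

text \<open>
  Write \<open>1 / f z = 1 / (f' 0 * z) + g z\<close> with \<open>g\<close> holomorphic in the disc. The coefficient functional
  is \<open>1 / |f' 0|\<^sup>2 \<plusminus> Re (A f)\<close> where \<open>A f = g' 0 / f' 0\<close> is, up to a constant, the Schwarzian derivative
  of \<open>f\<close> at \<open>0\<close> divided by \<open>(f' 0)\<^sup>2\<close>. Gronwall's area theorem gives
  \<open>|\<Omega>| \<le> \<pi> (1 / |f' 0|\<^sup>2 - |g' 0|\<^sup>2)\<close>, so \<open>|\<Omega>| / (2 \<pi>) \<le> 1 / |f' 0|\<^sup>2 - |A f|\<close> by the inequality between the
  arithmetic and geometric means.

  For the monotonicity, factor \<open>f = h \<circ> \<omega>\<close>. By the chain rule for the Schwarzian derivative,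
  \<open>A f - A h = A \<omega> / (h' 0)\<^sup>2\<close>, so it suffices that \<open>|A \<omega>| \<le> 1 / |\<omega>' 0|\<^sup>2 - 1\<close> for univalent self-maps
  \<open>\<omega>\<close> of the disc. As \<open>1 / u + s * u\<close> is injective in the punctured disc for \<open>|s| \<le> 1\<close>, the function
  \<open>1 / \<omega> + s * \<omega>\<close> is univalent, and the area theorem bounds its linear coefficient \<open>\<omega>' 0 * (A \<omega> + s)\<close>
  by the residue \<open>1 / \<omega>' 0\<close>.

  The area theorem is proved without Green's formula. The omitted set and the image of the annulus
  \<open>\<rho> < |z| < r\<close> are disjoint subsets of the inside of the image of \<open>|z| = \<rho>\<close>, which lies in an ellipse
  of area \<open>\<pi> |\<gamma>|\<^sup>2 / \<rho>\<^sup>2 + o(1)\<close> as \<open>\<rho> \<rightarrow> 0\<close>, where \<open>\<gamma>\<close> is the residue. The area of the image of the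
  annulus is bounded from below in logarithmic coordinates by Bessel's inequality on circles.
\<close>

section \<open>Integrals in permuted coordinates\<close>

lemma measure_not_fmeasurable: "A \<notin> fmeasurable M \<Longrightarrow> measure M A = 0"
  by (cases "A \<in> sets M")
     (auto simp: fmeasurable_def measure_def emeasure_notin_sets less_top[symmetric])

locale coordinate_isomorphism =
  fixes f :: "'a::euclidean_space \<Rightarrow> 'b::euclidean_space"
  assumes linear: "linear f" and bij_betw_Basis: "bij_betw f Basis Basis"
begin

lemma inner_image_Basis:
  assumes "b \<in> Basis"
  shows "f x \<bullet> f b = x \<bullet> b"
proof -
  have "f x = f (\<Sum>c\<in>Basis. (x \<bullet> c) *\<^sub>R c)"
    by (simp add: euclidean_representation)
  also have "\<dots> = (\<Sum>c\<in>Basis. (x \<bullet> c) *\<^sub>R f c)"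
    by (simp add: linear_sum[OF linear] linear_cmul[OF linear])
  finally have "f x \<bullet> f b = (\<Sum>c\<in>Basis. (x \<bullet> c) * (f c \<bullet> f b))"
    by (simp add: inner_sum_left)
  also have "\<dots> = (\<Sum>c\<in>Basis. if c = b then x \<bullet> b else 0)"
    using bij_betw_Basis assms
    by (intro sum.cong)
       (auto simp: inner_Basis bij_betw_apply bij_betw_imp_inj_on[THEN inj_on_eq_iff])
  finally show ?thesis using assms by simp
qed

lemma norm_image: "norm (f x) = norm x"
proof -
  have "f x \<bullet> f x = (\<Sum>b\<in>Basis. (f x \<bullet> b) * (f x \<bullet> b))"
    by (rule euclidean_inner)
  also have "\<dots> = (\<Sum>b\<in>Basis. (f x \<bullet> f b) * (f x \<bullet> f b))"
    by (rule sum.reindex_bij_betw[OF bij_betw_Basis, symmetric])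
  also have "\<dots> = x \<bullet> x"
    by (simp add: inner_image_Basis euclidean_inner[of x x])
  finally show ?thesis by (simp add: norm_eq_sqrt_inner)
qed

lemma bij: "bij f"
proof (rule bijI)
  show "inj f"
    unfolding linear_inj_iff_eq_0[OF linear] by (metis norm_image norm_eq_zero)
  have "range f = span (f ` Basis)"
    using linear_span_image[OF linear, of Basis] by simp
  then show "surj f"
    using bij_betw_Basis by (simp add: bij_betw_def)
qed

lemma coordinate_isomorphism_inv: "coordinate_isomorphism (inv f)"
proof (rule coordinate_isomorphism.intro)
  show "linear (inv f)"
    using bij linear
    by (intro linearI inv_f_eq)
       (simp_all add: bij_is_inj linear_add linear_cmul bij_is_surj surj_f_inv_f)
  show "bij_betw (inv f) Basis Basis"
    by (rule bij_betw_inv_into_subset[OF bij]) (use bij_betw_Basis in \<open>simp_all add: bij_betw_def\<close>)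
qed

lemma image_cbox: "f ` cbox a b = cbox (f a) (f b)"
proof -
  have "f x \<in> cbox (f a) (f b) \<longleftrightarrow> (\<forall>c\<in>f ` Basis. f a \<bullet> c \<le> f x \<bullet> c \<and> f x \<bullet> c \<le> f b \<bullet> c)" for x
    using bij_betw_Basis by (simp add: mem_box bij_betw_def)
  then have "f -` cbox (f a) (f b) = cbox a b"
    by (auto simp: inner_image_Basis mem_box)
  then show ?thesis
    using bij by (metis bij_is_surj surj_image_vimage_eq)
qed

lemma measure_image_cbox: "measure lborel (f ` cbox a b) = measure lborel (cbox a b)"
proof -
  have image_Basis: "f ` Basis = Basis" using bij_betw_Basis by (simp add: bij_betw_def)
  have "(\<forall>i\<in>Basis. f a \<bullet> i \<le> f b \<bullet> i) \<longleftrightarrow> (\<forall>i\<in>Basis. a \<bullet> i \<le> b \<bullet> i)"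
    by (subst image_Basis[symmetric]) (simp add: inner_image_Basis)
  moreover have "(\<Prod>i\<in>Basis. f b \<bullet> i - f a \<bullet> i) = (\<Prod>i\<in>Basis. b \<bullet> i - a \<bullet> i)"
    by (subst prod.reindex_bij_betw[OF bij_betw_Basis, symmetric]) (simp add: inner_image_Basis)
  ultimately show ?thesis by (simp add: image_cbox content_cbox_cases)
qed

lemma has_integral_vimage_cbox:
  fixes \<phi> :: "'b \<Rightarrow> 'c::real_normed_vector"
  assumes "(\<phi> has_integral i) (cbox (f a) (f b))"
  shows "((\<lambda>x. \<phi> (f x)) has_integral i) (cbox a b)"
proof -
  have f_inv: "f (inv f y) = y" and inv_f: "inv f (f x) = x" for x y
    using bij by (simp_all add: bij_is_surj surj_f_inv_f bij_is_inj)
  have "((\<lambda>x. \<phi> (f x)) has_integral (1 / 1) *\<^sub>R i) (inv f ` cbox (f a) (f b))"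
  proof (rule has_integral_twiddle[where g = f])
    show "isCont f x" for x
      using linear by (simp add: linear_continuous_at linear_linear)
    show "\<exists>w z. f ` cbox u v = cbox w z" for u v using image_cbox by blast
    show "\<exists>w z. inv f ` cbox u v = cbox w z" for u v
      using coordinate_isomorphism.image_cbox[OF coordinate_isomorphism_inv] by blast
  qed (use assms f_inv inv_f measure_image_cbox in simp_all)
  then show ?thesis by (simp add: image_cbox[symmetric] image_image inv_f)
qed

lemma has_integral_vimage:
  fixes \<phi> :: "'b \<Rightarrow> 'c::banach"
  assumes "(\<phi> has_integral i) S"
  shows "((\<lambda>x. \<phi> (f x)) has_integral i) (f -` S)"
  unfolding has_integral' [of _ _ "f -` S"]
proof (intro allI impI)
  fix e :: real assume "e > 0"
  with assms obtain B where B: "B > 0" "\<And>u v. ball 0 B \<subseteq> cbox u v \<Longrightarrow>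
      \<exists>z. ((\<lambda>y. if y \<in> S then \<phi> y else 0) has_integral z) (cbox u v) \<and> norm (z - i) < e"
    unfolding has_integral' [of _ _ S] by meson
  have "\<exists>z. ((\<lambda>x. if x \<in> f -` S then \<phi> (f x) else 0) has_integral z) (cbox u v) \<and> norm (z - i) < e"
    if "ball 0 B \<subseteq> cbox u v" for u v :: 'a
  proof -
    have "ball 0 B \<subseteq> cbox (f u) (f v)"
    proof
      fix y :: 'b assume "y \<in> ball 0 B"
      moreover obtain x where "y = f x" using bij by (meson bij_is_surj surjD)
      ultimately show "y \<in> cbox (f u) (f v)"
        using that norm_image unfolding image_cbox[symmetric] by auto
    qed
    from B(2)[OF this] obtain z where
      z: "((\<lambda>y. if y \<in> S then \<phi> y else 0) has_integral z) (cbox (f u) (f v))" "norm (z - i) < e"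
      by blast
    from has_integral_vimage_cbox[OF z(1)] z(2) show ?thesis by auto
  qed
  with B(1) show "\<exists>B>0. \<forall>u v. ball 0 B \<subseteq> cbox u v \<longrightarrow>
      (\<exists>z. ((\<lambda>x. if x \<in> f -` S then \<phi> (f x) else 0) has_integral z) (cbox u v) \<and> norm (z - i) < e)"
    by blast
qed

lemma has_integral_vimage_iff:
  fixes \<phi> :: "'b \<Rightarrow> 'c::banach"
  shows "((\<lambda>x. \<phi> (f x)) has_integral i) (f -` S) \<longleftrightarrow> (\<phi> has_integral i) S"
proof
  assume "((\<lambda>x. \<phi> (f x)) has_integral i) (f -` S)"
  from coordinate_isomorphism.has_integral_vimage[OF coordinate_isomorphism_inv this]
  show "(\<phi> has_integral i) S"
    using bij by (simp add: vimage_def bij_is_surj surj_f_inv_f)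
qed (rule has_integral_vimage)

lemma integral_vimage:
  fixes \<phi> :: "'b \<Rightarrow> 'c::banach"
  shows "integral (f -` S) (\<lambda>x. \<phi> (f x)) = integral S \<phi>"
  unfolding integral_def integrable_on_def has_integral_vimage_iff ..

lemma lmeasurable_vimage_iff: "f -` S \<in> lmeasurable \<longleftrightarrow> S \<in> lmeasurable"
  unfolding lmeasurable_iff_integrable_on integrable_on_def
  using has_integral_vimage_iff[of "\<lambda>_. 1 :: real"] by simp

lemma measure_vimage: "measure lebesgue (f -` S) = measure lebesgue S"
proof (cases "S \<in> lmeasurable")
  case True
  then show ?thesis
    using integral_vimage[of S "\<lambda>_. 1 :: real"]
    by (simp add: lmeasure_integral lmeasurable_vimage_iff)
qed (simp add: measure_not_fmeasurable lmeasurable_vimage_iff)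

end

section \<open>Area of holomorphic images\<close>

text \<open>
  The change of variables theorem of the library is restricted to the types \<open>real^'n\<close>, and Fubini's
  theorem for continuous functions to product types.
\<close>

definition complex_of_vec :: "real^2 \<Rightarrow> complex" where
  "complex_of_vec v = Complex (v $ 1) (v $ 2)"

definition vec_of_complex :: "complex \<Rightarrow> real^2" where
  "vec_of_complex z = vector [Re z, Im z]"

lemma complex_of_vec_inverse [simp]: "vec_of_complex (complex_of_vec v) = v"
  by (simp add: vec_of_complex_def complex_of_vec_def vec_eq_iff forall_2)

lemma vec_of_complex_inverse [simp]: "complex_of_vec (vec_of_complex z) = z"
  by (simp add: vec_of_complex_def complex_of_vec_def)

lemma linear_vec_of_complex: "linear vec_of_complex"
  by (rule linearI) (simp_all add: vec_of_complex_def vec_eq_iff forall_2)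

lemma complex_of_vec_axis: "complex_of_vec (axis 1 1) = 1" "complex_of_vec (axis 2 1) = \<i>"
  by (simp_all add: complex_of_vec_def axis_def complex_eq_iff)

interpretation complex_of_vec: coordinate_isomorphism complex_of_vec
proof (rule coordinate_isomorphism.intro)
  show "linear complex_of_vec"
    by (rule linearI) (simp_all add: complex_of_vec_def complex_eq_iff)
  have Basis_vec: "(Basis :: (real^2) set) = {axis 1 1, axis 2 1}"
    by (auto simp: Basis_vec_def UNIV_2)
  show "bij_betw complex_of_vec Basis Basis"
    unfolding Basis_vec Basis_complex_def by (auto simp: complex_of_vec_axis bij_betw_def)
qed

interpretation Complex: coordinate_isomorphism "\<lambda>(x, y). Complex x y"
proof (rule coordinate_isomorphism.intro)
  show "linear (\<lambda>(x, y). Complex x y)"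
    by (rule linearI) (auto simp: complex_eq_iff)
  show "bij_betw (\<lambda>(x, y). Complex x y) Basis Basis"
    by (auto simp: Basis_prod_def Basis_complex_def bij_betw_def complex_eq_iff)
qed

definition real_det :: "(complex \<Rightarrow> complex) \<Rightarrow> real" where
  "real_det L = Re (L 1) * Im (L \<i>) - Im (L 1) * Re (L \<i>)"

lemma det_matrix_conj_complex: "det (matrix (vec_of_complex \<circ> L \<circ> complex_of_vec)) = real_det L"
  by (simp add: det_2 matrix_def vec_of_complex_def complex_of_vec_axis real_det_def)

lemma real_det_mult: "real_det ((*) c) = (norm c)\<^sup>2"
  unfolding real_det_def cmod_power2 by (simp add: power2_eq_square)

lemma image_vec_of_complex: "vec_of_complex ` S = complex_of_vec -` S"
  by (auto simp: image_iff) (metis complex_of_vec_inverse)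

lemma vimage_complex_of_vec_image:
  "complex_of_vec -` (F ` S) = (vec_of_complex \<circ> F \<circ> complex_of_vec) ` (complex_of_vec -` S)"
  by (simp add: image_image flip: image_vec_of_complex)

lemma measure_linear_image_complex:
  fixes L :: "complex \<Rightarrow> complex"
  assumes "linear L" and "S \<in> lmeasurable"
  shows "measure lebesgue (L ` S) = \<bar>real_det L\<bar> * measure lebesgue S"
proof -
  have "linear (vec_of_complex \<circ> L \<circ> complex_of_vec)"
    by (intro linear_compose complex_of_vec.linear linear_vec_of_complex assms)
  then have "measure lebesgue (complex_of_vec -` (L ` S)) =
      \<bar>real_det L\<bar> * measure lebesgue (complex_of_vec -` S)"
    using assms(2)
    unfolding vimage_complex_of_vec_image det_matrix_conj_complex[symmetric]
    by (intro measure_linear_image) (simp_all add: complex_of_vec.lmeasurable_vimage_iff)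
  then show ?thesis by (simp only: complex_of_vec.measure_vimage)
qed

lemma measure_differentiable_image_complex:
  fixes F :: "complex \<Rightarrow> complex"
  assumes S: "S \<in> lmeasurable"
    and F': "\<And>z. z \<in> S \<Longrightarrow> (F has_derivative F' z) (at z within S)"
    and inj: "inj_on F S"
    and int: "(\<lambda>z. \<bar>real_det (F' z)\<bar>) integrable_on S"
  shows "measure lebesgue (F ` S) = integral S (\<lambda>z. \<bar>real_det (F' z)\<bar>)"
proof -
  let ?c = complex_of_vec
  let ?F = "vec_of_complex \<circ> F \<circ> ?c" and ?F' = "\<lambda>v. vec_of_complex \<circ> F' (?c v) \<circ> ?c"
  have "measure lebesgue (F ` S) = measure lebesgue (?F ` (?c -` S))"
    by (simp only: complex_of_vec.measure_vimage flip: vimage_complex_of_vec_image)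
  also have "\<dots> = integral (?c -` S) (\<lambda>v. \<bar>det (matrix (?F' v))\<bar>)"
  proof (rule measure_differentiable_image_eq)
    show "?c -` S \<in> sets lebesgue"
      using S by (simp add: complex_of_vec.lmeasurable_vimage_iff fmeasurableD)
    show "inj_on ?F (?c -` S)"
      using inj unfolding image_vec_of_complex[symmetric]
      by (auto simp: inj_on_def) (metis vec_of_complex_inverse)
    show "(\<lambda>v. \<bar>det (matrix (?F' v))\<bar>) integrable_on (?c -` S)"
      using int complex_of_vec.has_integral_vimage[of "\<lambda>z. \<bar>real_det (F' z)\<bar>"]
      by (auto simp: det_matrix_conj_complex integrable_on_def)
    fix v assume v: "v \<in> ?c -` S"
    have "(F has_derivative F' (?c v)) (at (?c v) within ?c ` (?c -` S))"
      by (rule has_derivative_subset[OF F']) (use v in auto)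
    then show "(?F has_derivative ?F' v) (at v within ?c -` S)"
      by (intro diff_chain_within linear_imp_has_derivative complex_of_vec.linear
          linear_vec_of_complex)
  qed
  also have "\<dots> = integral S (\<lambda>z. \<bar>real_det (F' z)\<bar>)"
    by (simp add: det_matrix_conj_complex
        complex_of_vec.integral_vimage[where \<phi> = "\<lambda>z. \<bar>real_det (F' z)\<bar>"])
  finally show ?thesis .
qed

lemma measure_holomorphic_image_box:
  assumes H: "H holomorphic_on U" "open U" and sub: "cbox u v \<subseteq> U" and inj: "inj_on H (box u v)"
  shows "measure lebesgue (H ` box u v) = integral (cbox u v) (\<lambda>z. (norm (deriv H z))\<^sup>2)"
proof -
  have "continuous_on (cbox u v) (\<lambda>z. (norm (deriv H z))\<^sup>2)"
    by (intro continuous_intros continuous_on_subset[OF holomorphic_on_imp_continuous_on sub]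
        holomorphic_deriv H)
  then have "(\<lambda>z. (norm (deriv H z))\<^sup>2) integrable_on box u v"
    by (simp add: integrable_on_open_interval integrable_continuous)
  moreover have "(H has_derivative (*) (deriv H z)) (at z within box u v)" if "z \<in> box u v" for z
  proof (rule has_derivative_at_withinI)
    have "z \<in> U" using that sub box_subset_cbox by blast
    then show "(H has_derivative (*) (deriv H z)) (at z)"
      using holomorphic_derivI[OF H] by (simp add: has_field_derivative_def)
  qed
  ultimately have "measure lebesgue (H ` box u v) =
      integral (box u v) (\<lambda>z. \<bar>real_det ((*) (deriv H z))\<bar>)"
    by (intro measure_differentiable_image_complex inj) (simp_all add: real_det_mult)
  then show ?thesis by (simp add: real_det_mult integral_open_interval)
qed

lemma has_integral_cbox_complex:
  fixes \<phi> :: "complex \<Rightarrow> 'a::euclidean_space"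
  assumes "continuous_on (cbox (Complex a c) (Complex b d)) \<phi>"
  shows "((\<lambda>x. integral {c..d} (\<lambda>y. \<phi> (Complex x y))) has_integral
           integral (cbox (Complex a c) (Complex b d)) \<phi>) {a..b}"
proof -
  let ?P = "\<lambda>(x, y). Complex x y"
  have vimage: "?P -` cbox (Complex a c) (Complex b d) = cbox (a, c) (b, d)"
    by (auto simp: mem_box Basis_complex_def Basis_prod_def)
  have "continuous_on (cbox (a, c) (b, d)) ?P"
    by (rule linear_continuous_on) (use Complex.linear in \<open>simp add: linear_conv_bounded_linear\<close>)
  then have cont: "continuous_on (cbox (a, c) (b, d)) (\<lambda>v. \<phi> (?P v))"
    by (rule continuous_on_compose2[OF assms]) (use vimage in blast)
  then have "continuous_on {a..b} (\<lambda>x. integral (cbox c d) (\<lambda>y. \<phi> (Complex x y)))"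
    by (intro integral_continuous_on_param) (simp add: cbox_Pair_eq case_prod_beta)
  then have "((\<lambda>x. integral {c..d} (\<lambda>y. \<phi> (Complex x y))) has_integral
      integral {a..b} (\<lambda>x. integral {c..d} (\<lambda>y. \<phi> (Complex x y)))) {a..b}"
    by (simp add: integrable_continuous_real integrable_integral)
  also have "integral {a..b} (\<lambda>x. integral {c..d} (\<lambda>y. \<phi> (Complex x y))) =
      integral (cbox (Complex a c) (Complex b d)) \<phi>"
    using integral_prod_continuous[OF cont] Complex.integral_vimage[of _ \<phi>]
    by (simp flip: vimage)
  finally show ?thesis .
qed

section \<open>Bessel's inequality on circles\<close>

lemma has_integral_circle_coefficient:
  fixes r R :: real
  assumes f: "f holomorphic_on ball 0 R" "f has_fps_expansion F" and r: "0 < r" "r < R"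
  shows "((\<lambda>t. f (r * cis t) / (r * cis t) ^ n) has_integral 2 * of_real pi * fps_nth F n) {0..2*pi}"
proof -
  have "continuous_on (cball 0 r) f"
    by (rule continuous_on_subset[OF holomorphic_on_imp_continuous_on[OF f(1)]]) (use r in auto)
  moreover have "f holomorphic_on ball 0 r"
    by (rule holomorphic_on_subset[OF f(1)]) (use r in auto)
  ultimately have "((\<lambda>u. f u / (u - 0) ^ Suc n) has_contour_integral
      of_real (2 * pi) * \<i> / fact n * (deriv ^^ n) f 0) (circlepath 0 r)"
    by (rule Cauchy_has_contour_integral_higher_derivative_circlepath) (use r in auto)
  then have "((\<lambda>t. f (r * cis t) / (r * cis t) ^ Suc n * r * \<i> * cis t)
      has_integral 2 * of_real pi * \<i> * fps_nth F n) {0..2*pi}"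
    unfolding circlepath_def fps_nth_fps_expansion[OF f(2)]
    by (subst (asm) has_contour_integral_part_circlepath_iff) auto
  from has_integral_mult_right[OF this, of "-\<i>"] show ?thesis
    by (rule has_integral_eq_rhs[OF has_integral_eq, rotated 1])
       (use r in \<open>auto simp: field_simps\<close>)
qed

lemma integrable_norm_circle:
  fixes r R :: real
  assumes f: "f holomorphic_on ball 0 R" and r: "0 < r" "r < R"
  shows "(\<lambda>t. (norm (f (r * cis t)))\<^sup>2) integrable_on {0..2*pi}"
  by (intro integrable_continuous_real continuous_intros
        continuous_on_compose2[OF holomorphic_on_imp_continuous_on[OF f]])
     (use r in \<open>auto simp: norm_mult\<close>)

lemma norm_diff_monomial_squared:
  fixes w a z :: complex
  assumes "z \<noteq> 0"
  shows "(norm (w - a * z ^ n))\<^sup>2 = (norm w)\<^sup>2 + (norm a)\<^sup>2 * norm z ^ (2 * n) -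
           2 * Re (cnj a * norm z ^ (2 * n) * (w / z ^ n))"
proof -
  have "cnj (z ^ n) * z ^ n = norm z ^ (2 * n)"
    using complex_norm_square[of "z ^ n"] by (simp add: norm_power power_mult mult.commute)
  then have cnj: "cnj (a * z ^ n) * w = cnj a * norm z ^ (2 * n) * (w / z ^ n)"
    using assms by (simp add: field_simps)
  have "(norm (w - u))\<^sup>2 = (norm w)\<^sup>2 + (norm u)\<^sup>2 - 2 * Re (cnj u * w)" for u
    unfolding cmod_power2 by (simp add: power2_eq_square algebra_simps)
  from this[of "a * z ^ n"] have "(norm (w - a * z ^ n))\<^sup>2 =
      (norm w)\<^sup>2 + (norm (a * z ^ n))\<^sup>2 - 2 * Re (cnj a * norm z ^ (2 * n) * (w / z ^ n))"
    unfolding cnj .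
  then show ?thesis
    by (simp add: norm_mult norm_power power_mult_distrib power_mult mult.commute)
qed

lemma circle_norm_integral_subtract_coefficient:
  fixes r R :: real
  assumes f: "f holomorphic_on ball 0 R" "f has_fps_expansion F" and r: "0 < r" "r < R"
  shows "integral {0..2*pi} (\<lambda>t. (norm (f (r * cis t) - fps_nth F n * (r * cis t) ^ n))\<^sup>2) =
           integral {0..2*pi} (\<lambda>t. (norm (f (r * cis t)))\<^sup>2) -
           2 * pi * (norm (fps_nth F n))\<^sup>2 * r ^ (2 * n)"
proof -
  define a where "a = fps_nth F n"
  have cross: "((\<lambda>t. Re (cnj a * r ^ (2 * n) * (f (r * cis t) / (r * cis t) ^ n))) has_integral
      2 * pi * ((norm a)\<^sup>2 * r ^ (2 * n))) {0..2*pi}"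
  proof -
    have "Re (cnj a * r ^ (2 * n) * (2 * of_real pi * a)) = 2 * pi * ((norm a)\<^sup>2 * r ^ (2 * n))"
    proof -
      have "cnj a * r ^ (2 * n) * (2 * of_real pi * a) = of_real (2 * pi * ((norm a)\<^sup>2 * r ^ (2 * n)))"
        using complex_norm_square[of a] by (simp add: mult_ac)
      then show ?thesis by (simp only: Re_complex_of_real)
    qed
    then show ?thesis
      using has_integral_Re[OF has_integral_mult_right[OF
            has_integral_circle_coefficient[OF f r, of n],
          of "cnj a * r ^ (2 * n)"]] by (simp only: a_def)
  qed
  have "((\<lambda>t. (norm (f (r * cis t)))\<^sup>2) has_integral
      integral {0..2*pi} (\<lambda>t. (norm (f (r * cis t)))\<^sup>2)) {0..2*pi}"
    by (rule integrable_integral[OF integrable_norm_circle[OF f(1) r]])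
  moreover have "((\<lambda>_. (norm a)\<^sup>2 * r ^ (2 * n)) has_integral
      2 * pi * ((norm a)\<^sup>2 * r ^ (2 * n))) {0..2*pi}"
    using has_integral_const_real[of "(norm a)\<^sup>2 * r ^ (2 * n)" 0 "2 * pi"] by simp
  ultimately have "((\<lambda>t. (norm (f (r * cis t)))\<^sup>2 + (norm a)\<^sup>2 * r ^ (2 * n) -
        2 * Re (cnj a * r ^ (2 * n) * (f (r * cis t) / (r * cis t) ^ n))) has_integral
      integral {0..2*pi} (\<lambda>t. (norm (f (r * cis t)))\<^sup>2) + 2 * pi * ((norm a)\<^sup>2 * r ^ (2 * n)) -
        2 * (2 * pi * ((norm a)\<^sup>2 * r ^ (2 * n)))) {0..2*pi}"
    by (intro has_integral_diff has_integral_add has_integral_mult_right[OF cross])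
  then have "((\<lambda>t. (norm (f (r * cis t) - a * (r * cis t) ^ n))\<^sup>2) has_integral
      integral {0..2*pi} (\<lambda>t. (norm (f (r * cis t)))\<^sup>2) -
        2 * pi * ((norm a)\<^sup>2 * r ^ (2 * n))) {0..2*pi}"
    using r by (simp add: norm_diff_monomial_squared norm_mult mult.assoc)
  then show ?thesis
    by (simp add: integral_unique a_def mult.assoc)
qed

lemma Bessel_inequality_circle:
  fixes r R :: real
  assumes "f holomorphic_on ball 0 R" "f has_fps_expansion F" and r: "0 < r" "r < R" and "finite A"
  shows "2 * pi * (\<Sum>n\<in>A. (norm (fps_nth F n))\<^sup>2 * r ^ (2 * n)) \<le>
           integral {0..2*pi} (\<lambda>t. (norm (f (r * cis t)))\<^sup>2)"
  using \<open>finite A\<close> assms(1,2)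
proof (induction A arbitrary: f F)
  case empty
  then show ?case
    using integral_nonneg[OF integrable_norm_circle[OF _ r]] by simp
next
  case (insert m A)
  define f' where "f' = (\<lambda>z. f z - fps_nth F m * z ^ m)"
  define F' where "F' = F - fps_const (fps_nth F m) * fps_X ^ m"
  have "f' holomorphic_on ball 0 R"
    unfolding f'_def by (intro holomorphic_intros insert.prems)
  moreover have "f' has_fps_expansion F'"
    unfolding f'_def F'_def by (intro fps_expansion_intros insert.prems)
  ultimately have "2 * pi * (\<Sum>n\<in>A. (norm (fps_nth F' n))\<^sup>2 * r ^ (2 * n)) \<le>
      integral {0..2*pi} (\<lambda>t. (norm (f' (r * cis t)))\<^sup>2)"
    by (rule insert.IH)
  moreover have "fps_nth F' n = fps_nth F n" if "n \<in> A" for n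
    using that insert.hyps by (auto simp: F'_def)
  ultimately show ?case
    using circle_norm_integral_subtract_coefficient[OF insert.prems r, of m] insert.hyps
    by (simp add: f'_def algebra_simps)
qed

section \<open>The area theorem\<close>

text \<open>The area covered by the image of \<open>|z| = r\<close> per unit of \<open>ln r\<close>.\<close>

definition circle_area_density :: "(complex \<Rightarrow> complex) \<Rightarrow> real \<Rightarrow> real" where
  "circle_area_density G r = integral {0..2*pi} (\<lambda>t. (norm (r * cis t * deriv G (r * cis t)))\<^sup>2)"

lemma exp_cbox_subset_annulus:
  "exp ` cbox (Complex a c) (Complex b d) \<subseteq> cball 0 (exp b) - ball 0 (exp a)"
  by (auto simp: mem_box Basis_complex_def)

lemma exp_box_subset_annulus:
  "exp ` box (Complex a c) (Complex b d) \<subseteq> ball 0 (exp b) - cball 0 (exp a)"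
  by (auto simp: mem_box Basis_complex_def)

lemma inj_on_exp_box: "inj_on exp (box (Complex a 0) (Complex b (2*pi)))"
  by (rule inj_onI, rule exp_complex_eqI) (auto simp: mem_box Basis_complex_def)

lemma has_integral_circle_area_density:
  assumes G: "G holomorphic_on U" "open U" and sub: "cball 0 (exp b) - ball 0 (exp a) \<subseteq> U"
    and inj: "inj_on G (ball 0 (exp b) - cball 0 (exp a))"
  shows "((\<lambda>x. circle_area_density G (exp x)) has_integral
           measure lebesgue ((\<lambda>\<zeta>. G (exp \<zeta>)) ` box (Complex a 0) (Complex b (2*pi)))) {a..b}"
proof -
  define u v where "u = Complex a 0" and "v = Complex b (2*pi)"
  let ?H = "\<lambda>\<zeta>. G (exp \<zeta>)" and ?d = "\<lambda>\<zeta>. (norm (exp \<zeta> * deriv G (exp \<zeta>)))\<^sup>2"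
  have U': "open (exp -` U)"
    by (intro continuous_open_vimage assms continuous_intros)
  have cbox_U: "cbox u v \<subseteq> exp -` U"
    using exp_cbox_subset_annulus sub by (force simp: u_def v_def)
  have H: "?H holomorphic_on exp -` U"
    using holomorphic_on_compose_gen[OF _ G(1), of exp "exp -` U"]
    by (auto simp: o_def holomorphic_on_exp)
  have deriv_H: "deriv ?H \<zeta> = exp \<zeta> * deriv G (exp \<zeta>)" if "\<zeta> \<in> exp -` U" for \<zeta>
  proof (rule DERIV_imp_deriv)
    have "(G has_field_derivative deriv G (exp \<zeta>)) (at (exp \<zeta>))"
      using that by (intro holomorphic_derivI[OF G]) auto
    from DERIV_chain2[OF this DERIV_exp]
    show "(?H has_field_derivative exp \<zeta> * deriv G (exp \<zeta>)) (at \<zeta>)"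
      by (simp add: mult.commute)
  qed
  have "inj_on (G \<circ> exp) (box u v)"
    using exp_box_subset_annulus inj_on_exp_box
    by (intro comp_inj_on inj_on_subset[OF inj]) (simp_all add: u_def v_def)
  then have inj_H: "inj_on ?H (box u v)" by (simp add: o_def)
  have "measure lebesgue (?H ` box u v) = integral (cbox u v) (\<lambda>\<zeta>. (norm (deriv ?H \<zeta>))\<^sup>2)"
    by (rule measure_holomorphic_image_box[OF H U' cbox_U inj_H])
  also have "\<dots> = integral (cbox u v) ?d"
    by (rule integral_cong) (use deriv_H cbox_U in auto)
  finally have area: "measure lebesgue (?H ` box u v) = integral (cbox u v) ?d" .
  have cont: "continuous_on (cbox u v) ?d"
    by (intro continuous_intros continuous_on_compose2[OF holomorphic_on_imp_continuous_on[OF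
          holomorphic_deriv[OF G]]]) (use cbox_U in auto)
  show ?thesis
    unfolding area[unfolded u_def v_def]
    using has_integral_cbox_complex[OF cont[unfolded u_def v_def]]
    by (simp add: circle_area_density_def exp_eq_polar)
qed

lemma lmeasurable_holomorphic_image_annulus:
  fixes \<rho> r :: real
  assumes G: "G holomorphic_on U" and sub: "cball 0 r - ball 0 \<rho> \<subseteq> U"
    and inj: "inj_on G (ball 0 r - cball 0 \<rho>)"
  shows "G ` (ball 0 r - cball 0 \<rho>) \<in> lmeasurable"
proof (rule lmeasurable_open)
  show "open (G ` (ball 0 r - cball 0 \<rho>))"
    using sub by (intro open_mapping_thm3[OF holomorphic_on_subset[OF G] _ inj]) auto
  have "compact (G ` (cball 0 r - ball 0 \<rho>))"
    by (intro compact_continuous_image compact_diff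
        continuous_on_subset[OF holomorphic_on_imp_continuous_on[OF G] sub]) auto
  then show "bounded (G ` (ball 0 r - cball 0 \<rho>))"
    by (rule bounded_subset[OF compact_imp_bounded]) auto
qed

lemma integral_circle_area_density_le:
  assumes G: "G holomorphic_on U" "open U" and sub: "cball 0 (exp b) - ball 0 (exp a) \<subseteq> U"
    and inj: "inj_on G (ball 0 (exp b) - cball 0 (exp a))"
  shows "integral {a..b} (\<lambda>x. circle_area_density G (exp x)) \<le>
           measure lebesgue (G ` (ball 0 (exp b) - cball 0 (exp a)))"
proof -
  let ?B = "box (Complex a 0) (Complex b (2*pi))"
  have exp_B: "exp ` ?B \<subseteq> ball 0 (exp b) - cball 0 (exp a)"
    by (rule exp_box_subset_annulus)
  have "open (exp ` ?B)"
    by (rule open_mapping_thm3[OF holomorphic_on_exp open_box inj_on_exp_box])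
  moreover have "exp ` ?B \<subseteq> U" using exp_B sub by force
  ultimately have "open (G ` exp ` ?B)"
    by (rule open_mapping_thm3[OF holomorphic_on_subset[OF G(1)] _
          inj_on_subset[OF inj exp_B], rotated])
  then have "measure lebesgue (G ` exp ` ?B) \<le>
      measure lebesgue (G ` (ball 0 (exp b) - cball 0 (exp a)))"
    using exp_B
    by (intro measure_mono_fmeasurable lmeasurable_holomorphic_image_annulus[OF G(1) sub inj]) auto
  then show ?thesis
    using integral_unique[OF has_integral_circle_area_density[OF G sub inj]]
    by (simp add: image_image)
qed

definition ellipse :: "complex \<Rightarrow> complex \<Rightarrow> real \<Rightarrow> complex set" where
  "ellipse c \<kappa> R = {w. norm ((w - c) - \<kappa> * cnj (w - c)) \<le> R}"

lemma ellipse_eq_image_cball: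
  assumes "norm \<kappa> < 1"
  shows "ellipse c \<kappa> R = (+) c ` (\<lambda>v. v + \<kappa> * cnj v) ` cball 0 (R / (1 - (norm \<kappa>)\<^sup>2))"
proof -
  let ?k = "complex_of_real (1 - (norm \<kappa>)\<^sup>2)"
  have k: "1 - (norm \<kappa>)\<^sup>2 > 0" using assms by (simp add: abs_square_less_1)
  then have k0: "?k \<noteq> 0" by (simp only: of_real_eq_0_iff)
  have inverse: "v - \<mu> * cnj v + \<mu> * cnj (v - \<mu> * cnj v) = v * ?k" if "norm \<mu> = norm \<kappa>" for v \<mu>
    using complex_norm_square[of \<mu>] that by (simp add: algebra_simps)
  show ?thesis
  proof (intro subset_antisym subsetI)
    fix w assume w: "w \<in> ellipse c \<kappa> R"
    define u where "u = w - c - \<kappa> * cnj (w - c)"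
    define v where "v = u / ?k"
    have "v + \<kappa> * cnj v = (u + \<kappa> * cnj u) / ?k"
      by (simp add: v_def add_divide_distrib)
    also have "\<dots> = w - c"
      using inverse[of \<kappa> "w - c"] k0 by (simp add: u_def del: of_real_diff)
    finally have "w = c + (v + \<kappa> * cnj v)" by simp
    moreover have "norm v \<le> R / (1 - (norm \<kappa>)\<^sup>2)"
      using w k
      by (simp add: ellipse_def u_def v_def norm_divide divide_right_mono del: of_real_diff)
    ultimately show "w \<in> (+) c ` (\<lambda>v. v + \<kappa> * cnj v) ` cball 0 (R / (1 - (norm \<kappa>)\<^sup>2))"
      by auto
  next
    fix w assume "w \<in> (+) c ` (\<lambda>v. v + \<kappa> * cnj v) ` cball 0 (R / (1 - (norm \<kappa>)\<^sup>2))"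
    then obtain v where v: "w = c + (v + \<kappa> * cnj v)" "norm v \<le> R / (1 - (norm \<kappa>)\<^sup>2)" by auto
    then have "w - c - \<kappa> * cnj (w - c) = v * ?k"
      using inverse[of "- \<kappa>" v] by simp
    moreover have "norm (v * ?k) \<le> R"
      using v(2) k by (simp add: norm_mult pos_le_divide_eq del: of_real_diff)
    ultimately show "w \<in> ellipse c \<kappa> R" by (simp add: ellipse_def)
  qed
qed

lemma linear_add_cnj: "linear (\<lambda>v. v + \<kappa> * cnj v)"
  by (rule linearI) (simp_all add: algebra_simps scaleR_conv_of_real)

lemma
  assumes "norm \<kappa> < 1"
  shows compact_ellipse: "compact (ellipse c \<kappa> R)" and convex_ellipse: "convex (ellipse c \<kappa> R)"
  unfolding ellipse_eq_image_cball[OF assms]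
  by (intro compact_translation compact_continuous_image compact_cball continuous_intros)
     (intro convex_translation convex_linear_image convex_cball linear_add_cnj)

lemma connected_compl_ellipse: "norm \<kappa> < 1 \<Longrightarrow> connected (- ellipse c \<kappa> R)"
  by (intro connected_complement_bounded_convex compact_imp_bounded compact_ellipse
      convex_ellipse) auto

lemma measure_ellipse:
  assumes "norm \<kappa> < 1" and "R \<ge> 0"
  shows "measure lebesgue (ellipse c \<kappa> R) = pi * R\<^sup>2 / (1 - (norm \<kappa>)\<^sup>2)"
proof -
  let ?k = "1 - (norm \<kappa>)\<^sup>2"
  have k: "?k > 0" using assms by (simp add: abs_square_less_1)
  have "real_det (\<lambda>v. v + \<kappa> * cnj v) = ?k"
    unfolding real_det_def cmod_power2 by (simp add: algebra_simps power2_eq_square)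
  then have "measure lebesgue (ellipse c \<kappa> R) = ?k * measure lebesgue (cball (0::complex) (R / ?k))"
    using measure_linear_image_complex[OF linear_add_cnj, of "cball 0 (R / ?k)" \<kappa>] k
    by (simp add: ellipse_eq_image_cball[OF assms(1)] measure_translation)
  also have "\<dots> = pi * R\<^sup>2 / ?k"
    using k assms(2) by (simp add: content_cball unit_ball_vol_2 power_divide power2_eq_square)
  finally show ?thesis .
qed

lemma holomorphic_factor_at:
  assumes f: "f holomorphic_on S" and S: "open S" "a \<in> S"
  obtains h where "h holomorphic_on S" "h a = deriv f a" "\<And>z. z \<in> S \<Longrightarrow> f z = f a + (z - a) * h z"
proof
  let ?h = "\<lambda>z. if z = a then deriv f a else f z / (z - a) - f a / (z - a)"
  show "?h holomorphic_on S"
    by (rule pole_theorem_open[OF f S(1)]) auto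
  show "f z = f a + (z - a) * ?h z" if "z \<in> S" for z
    by (cases "z = a") (simp_all add: right_diff_distrib)
qed simp

lemma holomorphic_quadratic_remainder:
  assumes f: "f holomorphic_on S" and S: "open S" "cball a r \<subseteq> S"
  obtains M where "M \<ge> 0"
    "\<And>z. z \<in> cball a r \<Longrightarrow> norm (f z - f a - deriv f a * (z - a)) \<le> M * (norm (z - a))\<^sup>2"
proof (cases "r < 0")
  case False
  then have a: "a \<in> S" using S(2) by auto
  obtain h where h: "h holomorphic_on S" "h a = deriv f a" "\<And>z. z \<in> S \<Longrightarrow> f z = f a + (z - a) * h z"
    using holomorphic_factor_at[OF f S(1) a] by blast
  obtain k where k: "k holomorphic_on S" "\<And>z. z \<in> S \<Longrightarrow> h z = h a + (z - a) * k z"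
    using holomorphic_factor_at[OF h(1) S(1) a] by metis
  have "bounded (k ` cball a r)"
    by (intro compact_imp_bounded compact_continuous_image compact_cball
        continuous_on_subset[OF holomorphic_on_imp_continuous_on[OF k(1)] S(2)])
  then obtain M where M: "M > 0" "\<And>z. z \<in> cball a r \<Longrightarrow> norm (k z) \<le> M"
    by (auto simp: bounded_pos)
  have "norm (f z - f a - deriv f a * (z - a)) \<le> M * (norm (z - a))\<^sup>2" if z: "z \<in> cball a r" for z
  proof -
    have "z \<in> S" using z S(2) by blast
    then have "f z - f a - deriv f a * (z - a) = k z * (z - a)\<^sup>2"
      using h(2) h(3)[of z] k(2)[of z] by (simp add: power2_eq_square algebra_simps)
    then show ?thesis
      using mult_right_mono[OF M(2)[OF z], of "(norm (z - a))\<^sup>2"] by (simp add: norm_mult norm_power)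
  qed
  with M(1) show ?thesis by (intro that[of M]) auto
qed (use that[of 0] in auto)

lemma ellipse_radius_asymptotics:
  fixes n C E :: real
  assumes n: "n \<noteq> 0"
  shows "((\<lambda>\<rho>. (n / \<rho> + C * \<rho>\<^sup>2)\<^sup>2 / (1 - (E * \<rho>\<^sup>2 / n)\<^sup>2) - n\<^sup>2 / \<rho>\<^sup>2) \<longlongrightarrow> 0) (at_right 0)"
proof -
  let ?k = "\<lambda>\<rho>. 1 - (E * \<rho>\<^sup>2 / n)\<^sup>2"
  have k: "(?k \<longlongrightarrow> 1 - (E * 0\<^sup>2 / n)\<^sup>2) (at_right 0)"
    using n by (intro tendsto_intros) auto
  have "((\<lambda>\<rho>. (2 * n * C * \<rho> + C\<^sup>2 * \<rho> ^ 4 + E\<^sup>2 * \<rho>\<^sup>2) / ?k \<rho>) \<longlongrightarrow>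
      (2 * n * C * 0 + C\<^sup>2 * 0 ^ 4 + E\<^sup>2 * 0\<^sup>2) / (1 - (E * 0\<^sup>2 / n)\<^sup>2)) (at_right 0)"
    by (intro tendsto_intros k) auto
  moreover have "\<forall>\<^sub>F \<rho> in at_right 0. (2 * n * C * \<rho> + C\<^sup>2 * \<rho> ^ 4 + E\<^sup>2 * \<rho>\<^sup>2) / ?k \<rho> =
      (n / \<rho> + C * \<rho>\<^sup>2)\<^sup>2 / ?k \<rho> - n\<^sup>2 / \<rho>\<^sup>2"
  proof -
    have "\<forall>\<^sub>F \<rho> in at_right 0. ?k \<rho> > 0"
      by (rule order_tendstoD(1)[OF k]) simp
    moreover have "\<forall>\<^sub>F \<rho> in at_right 0. \<rho> > (0::real)"
      by (rule eventually_at_right_less)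
    ultimately show ?thesis
    proof eventually_elim
      case (elim \<rho>)
      have "2 * n * C * \<rho> + C\<^sup>2 * \<rho> ^ 4 + E\<^sup>2 * \<rho>\<^sup>2 = (n / \<rho> + C * \<rho>\<^sup>2)\<^sup>2 - n\<^sup>2 / \<rho>\<^sup>2 * ?k \<rho>"
        using elim n by (simp add: field_simps power2_eq_square power4_eq_xxxx)
      with elim(1) show ?case by (simp add: diff_divide_distrib)
    qed
  qed
  ultimately show ?thesis by (simp add: tendsto_cong)
qed

lemma has_integral_exp_power_sum:
  fixes n :: real and c :: "nat \<Rightarrow> real"
  assumes "a \<le> b"
  shows "((\<lambda>x. 2 * pi * (n\<^sup>2 / (exp x)\<^sup>2 + (\<Sum>k=1..N. (real k)\<^sup>2 * c k * exp x ^ (2 * k)))) has_integral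
           pi * (n\<^sup>2 / (exp a)\<^sup>2 - n\<^sup>2 / (exp b)\<^sup>2 +
             (\<Sum>k=1..N. k * c k * (exp b ^ (2 * k) - exp a ^ (2 * k))))) {a..b}"
    (is "(?m has_integral ?I) _")
proof -
  define M where "M = (\<lambda>x. pi * (- n\<^sup>2 / (exp x)\<^sup>2 + (\<Sum>k=1..N. k * c k * exp x ^ (2 * k))))"
  have "(M has_real_derivative ?m x) (at x)" for x
  proof -
    have "((\<lambda>x. - n\<^sup>2 / (exp x)\<^sup>2) has_real_derivative 2 * (n\<^sup>2 / (exp x)\<^sup>2)) (at x)"
      by (auto intro!: derivative_eq_intros simp: field_simps power2_eq_square power4_eq_xxxx)
    moreover have "((\<lambda>x. k * c k * exp x ^ (2 * k)) has_real_derivative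
        2 * ((real k)\<^sup>2 * c k * exp x ^ (2 * k))) (at x)" for k
      by (auto intro!: derivative_eq_intros simp: power2_eq_square simp flip: exp_of_nat_mult)
    ultimately have "(M has_real_derivative pi * (2 * (n\<^sup>2 / (exp x)\<^sup>2) +
        (\<Sum>k=1..N. 2 * ((real k)\<^sup>2 * c k * exp x ^ (2 * k))))) (at x)"
      unfolding M_def by (intro DERIV_cmult DERIV_add DERIV_sum)
    then show ?thesis
      by (simp add: distrib_left sum_distrib_left mult_ac)
  qed
  then have "(?m has_integral M b - M a) {a..b}"
    by (intro fundamental_theorem_of_calculus assms)
       (simp add: has_real_derivative_iff_has_vector_derivative has_vector_derivative_at_within)
  moreover have "M b - M a = ?I"
    by (simp add: M_def right_diff_distrib distrib_left sum_subtractf)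
  ultimately show ?thesis by simp
qed

lemma fps_expansion_nth_Suc_0 [simp]: "fps_nth (fps_expansion f 0) (Suc 0) = deriv f 0"
  by (simp add: fps_expansion_def)

locale univalent_simple_pole =
  fixes g :: "complex \<Rightarrow> complex" and \<gamma> :: complex
  assumes holomorphic_regular_part: "g holomorphic_on ball 0 1"
    and inj_on_ball: "inj_on (\<lambda>z. \<gamma> / z + g z) (ball 0 1 - {0})"
    and residue_nonzero: "\<gamma> \<noteq> 0"
begin

definition G :: "complex \<Rightarrow> complex" where
  "G z = \<gamma> / z + g z"

lemma holomorphic_G: "G holomorphic_on ball 0 1 - {0}"
  unfolding G_def[abs_def]
  by (intro holomorphic_intros holomorphic_on_subset[OF holomorphic_regular_part]) auto

lemma inj_on_G: "inj_on G (ball 0 1 - {0})"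
  using inj_on_ball by (simp add: G_def[abs_def])

lemma open_image_G: "open S \<Longrightarrow> S \<subseteq> ball 0 1 - {0} \<Longrightarrow> open (G ` S)"
  by (metis open_mapping_thm3 holomorphic_on_subset[OF holomorphic_G] inj_on_subset[OF inj_on_G])

lemma continuous_on_regular_part: "\<rho> < 1 \<Longrightarrow> continuous_on (cball 0 \<rho>) g"
  by (rule continuous_on_subset[OF
        holomorphic_on_imp_continuous_on[OF holomorphic_regular_part]]) auto

lemma closed_image_punctured_cball:
  assumes "\<rho> < 1"
  shows "closed (G ` (cball 0 \<rho> - {0}))"
proof -
  \<comment> \<open>Clearing the pole exhibits the image as a projection of a closed set along a compact factor.\<close>
  let ?T = "{v \<in> cball 0 \<rho> \<times> UNIV. \<gamma> + fst v * (g (fst v) - snd v) = 0}"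
  have "closed ?T"
    by (intro continuous_closed_preimage_constant closed_Times closed_cball closed_UNIV
          continuous_intros continuous_on_compose2[OF continuous_on_regular_part[OF assms]]) auto
  then have "closed {w. \<exists>z. z \<in> cball 0 \<rho> \<and> (z, w) \<in> ?T}"
    by (rule closed_compact_projection[OF compact_cball])
  moreover have "\<gamma> + z * (g z - w) = 0 \<longleftrightarrow> z \<noteq> 0 \<and> w = G z" for z w
    using residue_nonzero by (cases "z = 0") (auto simp: G_def field_simps add_eq_0_iff)
  then have "{w. \<exists>z. z \<in> cball 0 \<rho> \<and> (z, w) \<in> ?T} = G ` (cball 0 \<rho> - {0})"
    by (auto simp: image_iff)
  ultimately show ?thesis by simp
qed

lemma filterlim_G_at_infinity: "filterlim G at_infinity (at 0)"
proof -
  have "isCont g 0"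
    using holomorphic_on_imp_continuous_on[OF holomorphic_regular_part]
    by (simp add: continuous_on_eq_continuous_at)
  then have "(g \<longlongrightarrow> g 0) (at 0)" by (simp add: isCont_def)
  moreover have "filterlim (\<lambda>z. \<gamma> / z) at_infinity (at 0)"
    by (rule filterlim_divide_at_infinity[OF tendsto_const])
       (auto simp: residue_nonzero filterlim_ident)
  ultimately show ?thesis
    unfolding G_def[abs_def] by (simp add: tendsto_add_filterlim_at_infinity')
qed

lemma omitted_values_subset:
  assumes \<rho>: "0 < \<rho>" "\<rho> < 1" and S: "bounded S" "connected (- S)" "G ` sphere 0 \<rho> \<subseteq> S"
  shows "- G ` (cball 0 \<rho> - {0}) \<subseteq> S"
proof -
  let ?inside = "G ` (ball 0 \<rho> - {0})" and ?omitted = "- G ` (cball 0 \<rho> - {0})"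
  have "open ?inside"
    using \<rho> by (intro open_image_G open_delete) auto
  moreover have "open ?omitted"
    using closed_image_punctured_cball[OF \<rho>(2)] by (rule open_Compl)
  moreover have "- S \<subseteq> ?inside \<union> ?omitted"
  proof -
    have "cball 0 \<rho> - {0} \<subseteq> (ball 0 \<rho> - {0}) \<union> sphere 0 \<rho>" by auto
    then show ?thesis using S(3) by blast
  qed
  moreover have "?inside \<inter> ?omitted \<inter> - S = {}" by fastforce
  moreover have "?inside \<inter> - S \<noteq> {}"
  proof -
    obtain B where B: "\<And>w. w \<in> S \<Longrightarrow> norm w \<le> B" using S(1) by (auto simp: bounded_iff)
    have "\<forall>\<^sub>F z in at 0. norm (G z) > B"
      using filterlim_at_infinity_imp_norm_at_top[OF filterlim_G_at_infinity]
      by (simp add: filterlim_at_top_dense)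
    moreover have "\<forall>\<^sub>F z in at 0. z \<in> ball 0 \<rho> - {0}"
      using \<rho> by (intro eventually_at_in_open) auto
    ultimately have "\<forall>\<^sub>F z in at 0. G z \<in> ?inside \<inter> - S"
      by eventually_elim (use B in force)
    then show ?thesis
      using eventually_happens'[OF at_neq_bot] by blast
  qed
  ultimately show ?thesis using S(2) unfolding connected_def by blast
qed

lemma measure_omitted_add_annulus_le:
  assumes K: "K \<in> sets lebesgue" "K \<inter> G ` (ball 0 1 - {0}) = {}"
    and \<rho>: "0 < \<rho>" "\<rho> < r" "r < 1"
    and S: "compact S" "connected (- S)" "G ` sphere 0 \<rho> \<subseteq> S"
  shows "measure lebesgue K + measure lebesgue (G ` (ball 0 r - cball 0 \<rho>)) \<le> measure lebesgue S"
proof -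
  let ?A = "ball 0 r - cball 0 \<rho> :: complex set"
  have sub: "?A \<subseteq> ball 0 1 - {0}" "cball 0 \<rho> - {0} \<subseteq> ball 0 1 - {0::complex}" using \<rho> by auto
  have omitted: "- G ` (cball 0 \<rho> - {0}) \<subseteq> S"
    using \<rho> S by (intro omitted_values_subset) (auto intro: compact_imp_bounded)
  have "G ` ?A \<inter> G ` (cball 0 \<rho> - {0}) = {}"
    using inj_on_image_Int[OF inj_on_G sub] by auto
  then have AS: "G ` ?A \<subseteq> S" and KS: "K \<subseteq> S"
    using omitted K(2) sub(2) by blast+
  have A: "G ` ?A \<in> sets lebesgue"
    using open_image_G[OF _ sub(1)] by (simp add: open_Diff)
  have S': "S \<in> lmeasurable" using S(1) by (rule lmeasurable_compact)
  have "measure lebesgue K + measure lebesgue (G ` ?A) = measure lebesgue (K \<union> G ` ?A)"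
  proof -
    have "G ` ?A - K = G ` ?A" using K(2) sub(1) by blast
    then show ?thesis
      using measure_Un2[OF fmeasurableI2[OF S' KS K(1)] fmeasurableI2[OF S' AS A]] by simp
  qed
  also have "\<dots> \<le> measure lebesgue S"
    using KS AS K(1) A S' by (intro measure_mono_fmeasurable) auto
  finally show ?thesis .
qed

text \<open>
  On \<open>|z| = \<rho>\<close> the map \<open>w \<mapsto> w - \<kappa> cnj w\<close> with \<open>\<kappa> = beltrami_coeff \<rho>\<close> cancels the term \<open>g' 0 * z\<close>, which
  turns the image of the circle into a circle up to \<open>O(\<rho>\<^sup>2)\<close>.
\<close>

definition beltrami_coeff :: "real \<Rightarrow> complex" where
  "beltrami_coeff \<rho> = deriv g 0 * of_real (\<rho>\<^sup>2) / cnj \<gamma>"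

lemma norm_beltrami_coeff: "norm (beltrami_coeff \<rho>) = norm (deriv g 0) * \<rho>\<^sup>2 / norm \<gamma>"
  by (simp add: beltrami_coeff_def norm_mult norm_divide norm_power)

lemma G_minus_beltrami_coeff_cnj_G:
  fixes z :: complex
  assumes "z \<noteq> 0"
  defines "\<delta> \<equiv> g z - g 0 - deriv g 0 * z"
  shows "G z - g 0 - beltrami_coeff (norm z) * cnj (G z - g 0) =
           \<gamma> / z + \<delta> - beltrami_coeff (norm z) * cnj (deriv g 0 * z + \<delta>)"
proof -
  have "beltrami_coeff (norm z) * cnj (\<gamma> / z) = deriv g 0 * z"
    using assms residue_nonzero complex_norm_square[of z]
    by (simp add: beltrami_coeff_def field_simps)
  moreover have "G z - g 0 = \<gamma> / z + deriv g 0 * z + \<delta>"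
    by (simp add: G_def \<delta>_def)
  ultimately show ?thesis by (simp add: algebra_simps)
qed

lemma image_sphere_subset_ellipse:
  obtains C where "C \<ge> 0"
    "\<And>\<rho>. 0 < \<rho> \<Longrightarrow> \<rho> \<le> 1/2 \<Longrightarrow> G ` sphere 0 \<rho> \<subseteq> ellipse (g 0) (beltrami_coeff \<rho>) (norm \<gamma> / \<rho> + C * \<rho>\<^sup>2)"
proof -
  define E where "E = norm (deriv g 0)"
  obtain M where M: "M \<ge> 0" "\<And>z. norm z \<le> 1/2 \<Longrightarrow> norm (g z - g 0 - deriv g 0 * z) \<le> M * (norm z)\<^sup>2"
    using holomorphic_quadratic_remainder[OF holomorphic_regular_part open_ball, of 0 "1/2"]
    by (auto simp: cball_subset_ball_iff)
  define C where "C = M + E / norm \<gamma> * (E + M)"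
  have "norm (G z - g 0 - beltrami_coeff \<rho> * cnj (G z - g 0)) \<le> norm \<gamma> / \<rho> + C * \<rho>\<^sup>2"
    if \<rho>: "0 < \<rho>" "\<rho> \<le> 1/2" and z: "norm z = \<rho>" for \<rho> z
  proof -
    define \<delta> where "\<delta> = g z - g 0 - deriv g 0 * z"
    have \<delta>: "norm \<delta> \<le> M * \<rho>\<^sup>2" using M(2)[of z] z \<rho> by (simp add: \<delta>_def)
    have "norm (deriv g 0 * z) \<le> E"
      using z \<rho> by (simp add: norm_mult E_def mult_left_le)
    moreover have "M * \<rho>\<^sup>2 \<le> M" using \<rho> M(1) by (simp add: mult_left_le power_le_one)
    ultimately have "norm (deriv g 0 * z + \<delta>) \<le> E + M"
      using norm_triangle_ineq[of "deriv g 0 * z" \<delta>] \<delta> by linarith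
    then have "norm (beltrami_coeff \<rho> * cnj (deriv g 0 * z + \<delta>)) \<le> norm (beltrami_coeff \<rho>) * (E + M)"
      by (simp only: norm_mult[of "beltrami_coeff \<rho>"] complex_mod_cnj mult_left_mono norm_ge_zero)
    moreover have "norm (\<gamma> / z) = norm \<gamma> / \<rho>" using z by (simp add: norm_divide)
    moreover have "G z - g 0 - beltrami_coeff \<rho> * cnj (G z - g 0) =
        \<gamma> / z + \<delta> - beltrami_coeff \<rho> * cnj (deriv g 0 * z + \<delta>)"
      using G_minus_beltrami_coeff_cnj_G[of z] z \<rho> by (auto simp: \<delta>_def)
    ultimately have "norm (G z - g 0 - beltrami_coeff \<rho> * cnj (G z - g 0)) \<le>
        norm \<gamma> / \<rho> + M * \<rho>\<^sup>2 + norm (beltrami_coeff \<rho>) * (E + M)"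
      using norm_triangle_ineq4[of "\<gamma> / z + \<delta>" "beltrami_coeff \<rho> * cnj (deriv g 0 * z + \<delta>)"]
        norm_triangle_ineq[of "\<gamma> / z" \<delta>] \<delta> by simp
    also have "\<dots> = norm \<gamma> / \<rho> + C * \<rho>\<^sup>2"
      by (simp add: C_def norm_beltrami_coeff E_def algebra_simps)
    finally show ?thesis .
  qed
  moreover have "C \<ge> 0" using M(1) by (simp add: C_def E_def)
  ultimately show ?thesis by (intro that[of C]) (auto simp: ellipse_def)
qed

definition regular_coeff :: "nat \<Rightarrow> complex" where
  "regular_coeff n = fps_nth (fps_expansion g 0) n"

lemma regular_coeff_1: "regular_coeff 1 = deriv g 0"
  by (simp add: regular_coeff_def)

lemma mult_deriv_G:
  assumes z: "z \<in> ball 0 1 - {0}"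
  shows "z * deriv G z = (z\<^sup>2 * deriv g z - \<gamma>) / z"
proof -
  have "(G has_field_derivative deriv g z - \<gamma> / z\<^sup>2) (at z)"
    unfolding G_def[abs_def] using z
    by (auto intro!: derivative_eq_intros holomorphic_derivI[OF holomorphic_regular_part]
        simp: power2_eq_square)
  then show ?thesis
    using z by (simp add: DERIV_imp_deriv field_simps power2_eq_square)
qed

lemma circle_area_density_G:
  assumes \<rho>: "0 < \<rho>" "\<rho> < 1"
  shows "\<rho>\<^sup>2 * circle_area_density G \<rho> =
           integral {0..2*pi} (\<lambda>t. (norm ((\<rho> * cis t)\<^sup>2 * deriv g (\<rho> * cis t) - \<gamma>))\<^sup>2)"
  unfolding circle_area_density_def integral_mult_right[symmetric]
proof (rule integral_cong)
  fix t
  let ?z = "\<rho> * cis t"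
  have "?z * deriv G ?z = (?z\<^sup>2 * deriv g ?z - \<gamma>) / ?z"
    using \<rho> by (intro mult_deriv_G) (simp add: norm_mult)
  then have "(norm (?z * deriv G ?z))\<^sup>2 = (norm (?z\<^sup>2 * deriv g ?z - \<gamma>))\<^sup>2 / \<rho>\<^sup>2"
    using \<rho> by (simp only: norm_divide power_divide) (simp add: norm_mult)
  then show "\<rho>\<^sup>2 * (norm (?z * deriv G ?z))\<^sup>2 = (norm (?z\<^sup>2 * deriv g ?z - \<gamma>))\<^sup>2"
    using \<rho> by simp
qed

lemma circle_area_density_G_ge:
  assumes \<rho>: "0 < \<rho>" "\<rho> < 1"
  shows "2 * pi * ((norm \<gamma>)\<^sup>2 / \<rho>\<^sup>2 + (\<Sum>n=1..N. (real n)\<^sup>2 * (norm (regular_coeff n))\<^sup>2 * \<rho> ^ (2 * n)))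
           \<le> circle_area_density G \<rho>" (is "2 * pi * ?m \<le> _")
proof -
  define F where "F = (\<lambda>z. z\<^sup>2 * deriv g z - \<gamma>)"
  define \<Phi> where "\<Phi> = fps_X ^ 2 * fps_deriv (fps_expansion g 0) - fps_const \<gamma>"
  have F: "F holomorphic_on ball 0 1"
    unfolding F_def by (intro holomorphic_intros holomorphic_deriv holomorphic_regular_part) auto
  have F_expansion: "F has_fps_expansion \<Phi>"
    unfolding F_def \<Phi>_def
    by (intro fps_expansion_intros
        has_fps_expansion_fps_expansion[OF _ _ holomorphic_regular_part]) auto
  have coeff_0: "fps_nth \<Phi> 0 = - \<gamma>"
    by (simp add: \<Phi>_def fps_X_power_mult_nth)
  have coeff_Suc: "fps_nth \<Phi> (Suc n) = of_nat n * regular_coeff n" if "n \<ge> 1" for n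
    using that by (cases n) (simp_all add: \<Phi>_def regular_coeff_def fps_X_power_mult_nth)
  have "(\<Sum>n\<in>insert 0 (Suc ` {1..N}). (norm (fps_nth \<Phi> n))\<^sup>2 * \<rho> ^ (2 * n)) =
      (norm \<gamma>)\<^sup>2 + (\<Sum>n=1..N. (real n)\<^sup>2 * (norm (regular_coeff n))\<^sup>2 * \<rho> ^ (2 * Suc n))"
    by (simp add: sum.reindex coeff_0 coeff_Suc norm_mult power_mult_distrib
        del: image_Suc_atLeastAtMost)
  also have "\<dots> = \<rho>\<^sup>2 * ?m"
    using \<rho> by (simp add: distrib_left sum_distrib_left power2_eq_square mult_ac)
  finally have "2 * pi * (\<rho>\<^sup>2 * ?m) \<le> integral {0..2*pi} (\<lambda>t. (norm (F (\<rho> * cis t)))\<^sup>2)"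
    using Bessel_inequality_circle[OF F F_expansion \<rho>, of "insert 0 (Suc ` {1..N})"]
    by (simp del: image_Suc_atLeastAtMost)
  then have "\<rho>\<^sup>2 * (2 * pi * ?m) \<le> \<rho>\<^sup>2 * circle_area_density G \<rho>"
    unfolding circle_area_density_G[OF \<rho>] F_def by (simp only: mult.left_commute[of "2 * pi"])
  then show ?thesis
    by (rule mult_left_le_imp_le) (use \<rho> in simp)
qed

lemma measure_annulus_image_ge:
  assumes \<rho>: "0 < \<rho>" "\<rho> < r" "r < 1"
  shows "pi * ((norm \<gamma>)\<^sup>2 / \<rho>\<^sup>2 - (norm \<gamma>)\<^sup>2 / r\<^sup>2 +
             (\<Sum>n=1..N. n * (norm (regular_coeff n))\<^sup>2 * (r ^ (2 * n) - \<rho> ^ (2 * n))))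
           \<le> measure lebesgue (G ` (ball 0 r - cball 0 \<rho>))" (is "?lhs \<le> _")
proof -
  define a b where "a = ln \<rho>" and "b = ln r"
  have ab: "a \<le> b" "exp a = \<rho>" "exp b = r" using \<rho> by (auto simp: a_def b_def)
  have U: "open (ball 0 1 - {0::complex})" by auto
  have sub: "cball 0 (exp b) - ball 0 (exp a) \<subseteq> ball 0 1 - {0::complex}"
    using \<rho> by (auto simp: ab)
  have inj: "inj_on G (ball 0 (exp b) - cball 0 (exp a))"
    by (rule inj_on_subset[OF inj_on_G]) (use \<rho> in \<open>auto simp: ab\<close>)
  have density_ge: "2 * pi * ((norm \<gamma>)\<^sup>2 / (exp x)\<^sup>2 +
      (\<Sum>n=1..N. (real n)\<^sup>2 * (norm (regular_coeff n))\<^sup>2 * exp x ^ (2 * n)))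
      \<le> circle_area_density G (exp x)"
    if "x \<in> {a..b}" for x
  proof (rule circle_area_density_G_ge[OF exp_gt_zero])
    have "exp x \<le> exp b" using that by simp
    then show "exp x < 1" using \<rho>(3) unfolding ab by linarith
  qed
  have "?lhs \<le> integral {a..b} (\<lambda>x. circle_area_density G (exp x))"
    using has_integral_le[OF has_integral_exp_power_sum[OF ab(1)]
        integrable_integral[OF has_integral_integrable[OF
          has_integral_circle_area_density[OF holomorphic_G U sub inj]]] density_ge]
    by (simp only: ab)
  also have "\<dots> \<le> measure lebesgue (G ` (ball 0 r - cball 0 \<rho>))"
    using integral_circle_area_density_le[OF holomorphic_G U sub inj] by (simp only: ab)
  finally show ?thesis .
qed

lemma measure_omitted_le_ellipse:
  assumes K: "K \<in> sets lebesgue" "K \<inter> G ` (ball 0 1 - {0}) = {}"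
    and \<rho>: "0 < \<rho>" "\<rho> < r" "r < 1" and \<kappa>: "norm \<kappa> < 1" and R: "R \<ge> 0"
    and sphere: "G ` sphere 0 \<rho> \<subseteq> ellipse c \<kappa> R"
  shows "measure lebesgue K \<le> pi * ((norm \<gamma>)\<^sup>2 / r\<^sup>2 -
           (\<Sum>n=1..N. n * (norm (regular_coeff n))\<^sup>2 * (r ^ (2 * n) - \<rho> ^ (2 * n))) +
           (R\<^sup>2 / (1 - (norm \<kappa>)\<^sup>2) - (norm \<gamma>)\<^sup>2 / \<rho>\<^sup>2))"
proof -
  have "measure lebesgue K + measure lebesgue (G ` (ball 0 r - cball 0 \<rho>)) \<le>
      measure lebesgue (ellipse c \<kappa> R)"
    by (intro measure_omitted_add_annulus_le K \<rho> compact_ellipse connected_compl_ellipse \<kappa> sphere)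
  also have "\<dots> = pi * (R\<^sup>2 / (1 - (norm \<kappa>)\<^sup>2))"
    by (simp add: measure_ellipse \<kappa> R)
  finally show ?thesis
    using measure_annulus_image_ge[OF \<rho>, of N]
    unfolding right_diff_distrib[of pi] distrib_left[of pi] by linarith
qed

lemma area_theorem_subdisc:
  assumes K: "K \<in> sets lebesgue" "K \<inter> G ` (ball 0 1 - {0}) = {}" and r: "0 < r" "r < 1"
  shows "measure lebesgue K \<le>
           pi * ((norm \<gamma>)\<^sup>2 / r\<^sup>2 - (\<Sum>n=1..N. n * (norm (regular_coeff n))\<^sup>2 * r ^ (2 * n)))"
proof -
  define c where "c = (\<lambda>n. (norm (regular_coeff n))\<^sup>2)"
  obtain C where C: "C \<ge> 0"
      "\<And>\<rho>. 0 < \<rho> \<Longrightarrow> \<rho> \<le> 1/2 \<Longrightarrow>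
        G ` sphere 0 \<rho> \<subseteq> ellipse (g 0) (beltrami_coeff \<rho>) (norm \<gamma> / \<rho> + C * \<rho>\<^sup>2)"
    using image_sphere_subset_ellipse by metis
  let ?error = "\<lambda>\<rho>. (norm \<gamma> / \<rho> + C * \<rho>\<^sup>2)\<^sup>2 / (1 - (norm (beltrami_coeff \<rho>))\<^sup>2) - (norm \<gamma>)\<^sup>2 / \<rho>\<^sup>2"
  let ?bound = "\<lambda>\<rho>. pi * ((norm \<gamma>)\<^sup>2 / r\<^sup>2 -
      (\<Sum>n=1..N. n * c n * (r ^ (2 * n) - \<rho> ^ (2 * n))) + ?error \<rho>)"
  have error: "(?error \<longlongrightarrow> 0) (at_right 0)"
    unfolding norm_beltrami_coeff using residue_nonzero by (intro ellipse_radius_asymptotics) simp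
  show ?thesis
  proof (rule tendsto_lowerbound)
    have "(?bound \<longlongrightarrow> pi * ((norm \<gamma>)\<^sup>2 / r\<^sup>2 -
        (\<Sum>n=1..N. n * c n * (r ^ (2 * n) - 0 ^ (2 * n))) + 0)) (at_right 0)"
      by (intro tendsto_intros error)
    moreover have "(\<Sum>n=1..N. n * c n * (r ^ (2 * n) - 0 ^ (2 * n))) =
        (\<Sum>n=1..N. n * c n * r ^ (2 * n))"
      by (intro sum.cong) auto
    ultimately show "(?bound \<longlongrightarrow> pi * ((norm \<gamma>)\<^sup>2 / r\<^sup>2 -
        (\<Sum>n=1..N. n * (norm (regular_coeff n))\<^sup>2 * r ^ (2 * n)))) (at_right 0)" by (simp add: c_def)
    have "((\<lambda>\<rho>. norm (beltrami_coeff \<rho>)) \<longlongrightarrow> norm (deriv g 0) * 0\<^sup>2 / norm \<gamma>) (at_right 0)"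
      unfolding norm_beltrami_coeff using residue_nonzero by (intro tendsto_intros) auto
    then have "\<forall>\<^sub>F \<rho> in at_right 0. norm (beltrami_coeff \<rho>) < 1"
      by (rule order_tendstoD) auto
    moreover have "\<forall>\<^sub>F \<rho> in at_right 0. \<rho> \<in> {0<..<min r (1/2)}"
      by (rule eventually_at_right_real) (use r in auto)
    ultimately show "\<forall>\<^sub>F \<rho> in at_right 0. measure lebesgue K \<le> ?bound \<rho>"
    proof eventually_elim
      case (elim \<rho>)
      then show ?case
        unfolding c_def using C(1) r
        by (intro measure_omitted_le_ellipse[OF K _ _ r(2) _ _ C(2)]) auto
    qed
  qed simp
qed

theorem area_theorem:
  assumes K: "K \<in> sets lebesgue" "K \<inter> G ` (ball 0 1 - {0}) = {}"
  shows "measure lebesgue K \<le> pi * ((norm \<gamma>)\<^sup>2 - (\<Sum>n=1..N. n * (norm (regular_coeff n))\<^sup>2))"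
proof (rule tendsto_lowerbound)
  let ?bound = "\<lambda>r. pi * ((norm \<gamma>)\<^sup>2 / r\<^sup>2 - (\<Sum>n=1..N. n * (norm (regular_coeff n))\<^sup>2 * r ^ (2 * n)))"
  have "(?bound \<longlongrightarrow> ?bound 1) (at_left 1)"
    by (intro tendsto_intros) auto
  then show "(?bound \<longlongrightarrow> pi * ((norm \<gamma>)\<^sup>2 - (\<Sum>n=1..N. n * (norm (regular_coeff n))\<^sup>2))) (at_left 1)"
    by simp
  have "\<forall>\<^sub>F r in at_left 1. r \<in> {0<..<1::real}"
    by (rule eventually_at_left_real) auto
  then show "\<forall>\<^sub>F r in at_left 1. measure lebesgue K \<le> ?bound r"
    by eventually_elim (use area_theorem_subdisc[OF K] in auto)
qed simp

corollary area_theorem_deriv: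
  assumes "K \<in> sets lebesgue" "K \<inter> G ` (ball 0 1 - {0}) = {}"
  shows "measure lebesgue K \<le> pi * ((norm \<gamma>)\<^sup>2 - (norm (deriv g 0))\<^sup>2)"
  using area_theorem[OF assms, of 1] regular_coeff_1 by simp

corollary norm_deriv_regular_part_le: "norm (deriv g 0) \<le> norm \<gamma>"
proof -
  have "0 \<le> pi * ((norm \<gamma>)\<^sup>2 - (norm (deriv g 0))\<^sup>2)"
    using area_theorem_deriv[of "{}"] by simp
  then show ?thesis
    using pi_gt_zero by (auto simp: zero_le_mult_iff power2_le_iff_abs_le)
qed

end

section \<open>The Schwarzian derivative of univalent functions at the origin\<close>

definition univalent_fixing_0 :: "(complex \<Rightarrow> complex) \<Rightarrow> bool" where
  "univalent_fixing_0 f \<longleftrightarrow> f holomorphic_on ball 0 1 \<and> inj_on f (ball 0 1) \<and> f 0 = 0"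

lemma
  assumes "univalent_fixing_0 f"
  shows univalent_holomorphic: "f holomorphic_on ball 0 1"
    and univalent_inj_on: "inj_on f (ball 0 1)"
    and univalent_at_0: "f 0 = 0"
    and univalent_deriv_nonzero: "deriv f 0 \<noteq> 0"
    and univalent_nonzero: "z \<in> ball 0 1 - {0} \<Longrightarrow> f z \<noteq> 0"
proof -
  show holomorphic: "f holomorphic_on ball 0 1" and inj: "inj_on f (ball 0 1)" and zero: "f 0 = 0"
    using assms by (auto simp: univalent_fixing_0_def)
  show "deriv f 0 \<noteq> 0"
    by (rule holomorphic_injective_imp_regular[OF holomorphic _ inj]) auto
  show "f z \<noteq> 0" if "z \<in> ball 0 1 - {0}"
    using inj_onD[OF inj, of z 0] that zero by auto
qed

definition is_reciprocal_regular_part :: "(complex \<Rightarrow> complex) \<Rightarrow> (complex \<Rightarrow> complex) \<Rightarrow> bool" where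
  "is_reciprocal_regular_part f g \<longleftrightarrow>
     g holomorphic_on ball 0 1 \<and> (\<forall>z\<in>ball 0 1 - {0}. 1 / f z = 1 / deriv f 0 / z + g z)"

lemma reciprocal_regular_part_exists:
  assumes "univalent_fixing_0 f"
  obtains g where "is_reciprocal_regular_part f g"
proof -
  obtain h where h: "h holomorphic_on ball 0 1" "h 0 = deriv f 0" "\<And>z. z \<in> ball 0 1 \<Longrightarrow> f z = z * h z"
    using holomorphic_factor_at[OF univalent_holomorphic[OF assms], of 0] univalent_at_0[OF assms]
    by auto
  have "h z \<noteq> 0" if "z \<in> ball 0 1" for z
    using univalent_deriv_nonzero[OF assms] univalent_nonzero[OF assms, of z] h(2) h(3)[of z] that
    by (cases "z = 0") auto
  then have "(\<lambda>z. 1 / h z) holomorphic_on ball 0 1"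
    by (intro holomorphic_intros h(1)) auto
  then obtain g where g: "g holomorphic_on ball 0 1" "\<And>z. z \<in> ball 0 1 \<Longrightarrow> 1 / h z = 1 / h 0 + z * g z"
    using holomorphic_factor_at[of "\<lambda>z. 1 / h z" "ball 0 1" 0] by auto
  have "1 / f z = 1 / deriv f 0 / z + g z" if z: "z \<in> ball 0 1 - {0}" for z
  proof -
    have "1 / f z = (1 / h z) / z" using h(3)[of z] z by simp
    also have "\<dots> = 1 / deriv f 0 / z + g z"
      using g(2)[of z] z by (simp add: h(2) add_divide_distrib)
    finally show ?thesis .
  qed
  with g(1) have "is_reciprocal_regular_part f g"
    by (simp add: is_reciprocal_regular_part_def)
  then show ?thesis by (rule that)
qed

lemma univalent_simple_pole_reciprocal:
  assumes "univalent_fixing_0 f" and "is_reciprocal_regular_part f g"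
  shows "univalent_simple_pole g (1 / deriv f 0)"
proof
  have "inj_on (\<lambda>z. 1 / f z) (ball 0 1 - {0})"
    using univalent_inj_on[OF assms(1)] by (auto simp: inj_on_def)
  then show "inj_on (\<lambda>z. 1 / deriv f 0 / z + g z) (ball 0 1 - {0})"
    by (rule inj_on_cong[THEN iffD1, rotated])
       (use assms(2) in \<open>auto simp: is_reciprocal_regular_part_def\<close>)
qed (use assms(2) univalent_deriv_nonzero[OF assms(1)]
    in \<open>simp_all add: is_reciprocal_regular_part_def\<close>)

text \<open>In terms of the Schwarzian derivative \<open>S\<close>, this is \<open>- S f 0 / (6 * (f' 0)\<^sup>2)\<close>.\<close>

definition schwarzian_coeff :: "(complex \<Rightarrow> complex) \<Rightarrow> complex" where
  "schwarzian_coeff f = (let F = fps_expansion f 0 in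
     ((fps_nth F 2)\<^sup>2 / fps_nth F 1 - fps_nth F 3) / fps_nth F 1 ^ 3)"

lemma fps_reciprocal_nth_1:
  fixes F H :: "'a::field fps"
  assumes F0: "fps_nth F 0 = 0" and F1: "fps_nth F 1 \<noteq> 0"
    and eq: "F * (fps_const (1 / fps_nth F 1) + fps_X * H) = fps_X"
  shows "fps_nth H 1 =
           fps_nth F 1 * (((fps_nth F 2)\<^sup>2 / fps_nth F 1 - fps_nth F 3) / fps_nth F 1 ^ 3)"
proof -
  define b1 b2 b3 where "b1 = fps_nth F 1" and "b2 = fps_nth F 2" and "b3 = fps_nth F 3"
  have b1: "b1 \<noteq> 0" using F1 by (simp add: b1_def)
  have "b1 * fps_nth H 0 + b2 * (1 / b1) = 0"
    using arg_cong[OF eq, of "\<lambda>A. fps_nth A 2", unfolded fps_mult_nth]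
    by (simp add: F0 b1_def b2_def eval_nat_numeral)
  then have H0: "fps_nth H 0 = - b2 / b1 ^ 2"
    using b1 by (simp add: field_simps power2_eq_square add_eq_0_iff)
  have "b1 * fps_nth H 1 + b2 * fps_nth H 0 + b3 * (1 / b1) = 0"
    using arg_cong[OF eq, of "\<lambda>A. fps_nth A 3", unfolded fps_mult_nth]
    by (simp add: F0 b1_def b2_def b3_def eval_nat_numeral)
  then have "b1 * fps_nth H 1 = b2\<^sup>2 / b1 ^ 2 - b3 / b1"
    by (simp add: H0 power2_eq_square add_eq_0_iff)
  then have "fps_nth H 1 = (b2\<^sup>2 / b1 ^ 2 - b3 / b1) / b1"
    using b1 by (simp add: eq_divide_eq mult.commute)
  also have "\<dots> = b1 * ((b2\<^sup>2 / b1 - b3) / b1 ^ 3)"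
    using b1 by (simp add: field_simps power2_eq_square power3_eq_cube)
  finally show ?thesis unfolding b1_def b2_def b3_def .
qed

lemma deriv_reciprocal_regular_part:
  assumes f: "univalent_fixing_0 f" and g: "is_reciprocal_regular_part f g"
  shows "deriv g 0 = deriv f 0 * schwarzian_coeff f"
proof -
  define F H where "F = fps_expansion f 0" and "H = fps_expansion g 0"
  define \<gamma> where "\<gamma> = 1 / deriv f 0"
  have F: "f has_fps_expansion F" and H: "g has_fps_expansion H"
    unfolding F_def H_def using univalent_holomorphic[OF f] g
    by (auto simp: is_reciprocal_regular_part_def
        intro!: has_fps_expansion_fps_expansion[of "ball 0 1"])
  have "f z * (\<gamma> + z * g z) = z" if "z \<in> ball 0 1" for z
  proof (cases "z = 0")
    case False
    with that g univalent_nonzero[OF f, of z] have "1 / f z = \<gamma> / z + g z" "f z \<noteq> 0"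
      by (auto simp: is_reciprocal_regular_part_def \<gamma>_def)
    with False show ?thesis by (simp add: field_simps)
  qed (simp add: univalent_at_0[OF f])
  then have "\<forall>\<^sub>F z in nhds 0. f z * (\<gamma> + z * g z) = z"
    by (intro eventually_nhds_in_open[of "ball 0 1", THEN eventually_mono]) auto
  moreover have "(\<lambda>z. f z * (\<gamma> + z * g z)) has_fps_expansion F * (fps_const \<gamma> + fps_X * H)"
    by (intro fps_expansion_intros F H)
  ultimately have "(\<lambda>z. z) has_fps_expansion F * (fps_const \<gamma> + fps_X * H)"
    by (simp add: has_fps_expansion_cong[OF _ refl])
  then have "F * (fps_const \<gamma> + fps_X * H) = fps_X"
    using has_fps_expansion_fps_X fps_expansion_unique_complex by blast
  then have "fps_nth H 1 =
      fps_nth F 1 * (((fps_nth F 2)\<^sup>2 / fps_nth F 1 - fps_nth F 3) / fps_nth F 1 ^ 3)"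
    using univalent_at_0[OF f] univalent_deriv_nonzero[OF f]
    by (intro fps_reciprocal_nth_1) (simp_all add: F_def \<gamma>_def fps_expansion_def)
  then show ?thesis
    unfolding F_def H_def by (simp add: schwarzian_coeff_def Let_def)
qed

lemma DERIV_holomorphic_at_0:
  "\<phi> holomorphic_on ball 0 1 \<Longrightarrow> (\<phi> has_field_derivative deriv \<phi> 0) (at 0)"
  by (rule holomorphic_derivI[of _ "ball 0 1"]) auto

lemma DERIV_compose_fixing_0:
  assumes "\<phi> holomorphic_on ball 0 1" and "univalent_fixing_0 \<omega>"
  shows "((\<lambda>z. \<phi> (\<omega> z)) has_field_derivative deriv \<phi> 0 * deriv \<omega> 0) (at 0)"
  by (rule DERIV_chain2)
     (simp_all add: DERIV_holomorphic_at_0 assms univalent_holomorphic[OF assms(2)]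
        univalent_at_0[OF assms(2)])

lemma holomorphic_compose_self_map:
  assumes "\<phi> holomorphic_on S" "\<omega> holomorphic_on S" "\<omega> ` S \<subseteq> S"
  shows "(\<lambda>z. \<phi> (\<omega> z)) holomorphic_on S"
  using holomorphic_on_compose_gen[OF assms(2,1)] assms(3)
  by (simp add: o_def image_subset_iff_funcset)

lemma univalent_fixing_0_compose:
  assumes h: "univalent_fixing_0 h" and \<omega>: "univalent_fixing_0 \<omega>" "\<omega> ` ball 0 1 \<subseteq> ball 0 1"
  shows "univalent_fixing_0 (\<lambda>z. h (\<omega> z))"
  unfolding univalent_fixing_0_def
proof (intro conjI)
  show "(\<lambda>z. h (\<omega> z)) holomorphic_on ball 0 1"
    by (rule holomorphic_compose_self_map[OF univalent_holomorphic[OF h]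
          univalent_holomorphic[OF \<omega>(1)] \<omega>(2)])
  show "inj_on (\<lambda>z. h (\<omega> z)) (ball 0 1)"
    using comp_inj_on[OF univalent_inj_on[OF \<omega>(1)] inj_on_subset[OF univalent_inj_on[OF h] \<omega>(2)]]
    by (simp add: o_def)
qed (simp add: univalent_at_0[OF h] univalent_at_0[OF \<omega>(1)])

lemma reciprocal_regular_part_compose:
  assumes h: "univalent_fixing_0 h" and \<omega>: "univalent_fixing_0 \<omega>" "\<omega> ` ball 0 1 \<subseteq> ball 0 1"
    and u: "is_reciprocal_regular_part \<omega> u" and v: "is_reciprocal_regular_part h v"
  shows "is_reciprocal_regular_part (\<lambda>z. h (\<omega> z)) (\<lambda>z. 1 / deriv h 0 * u z + v (\<omega> z))"
  unfolding is_reciprocal_regular_part_def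
proof (intro conjI ballI)
  have u_holo: "u holomorphic_on ball 0 1" and v_holo: "v holomorphic_on ball 0 1"
    using u v by (simp_all add: is_reciprocal_regular_part_def)
  show "(\<lambda>z. 1 / deriv h 0 * u z + v (\<omega> z)) holomorphic_on ball 0 1"
    by (intro holomorphic_intros u_holo holomorphic_compose_self_map[OF v_holo]
        univalent_holomorphic \<omega>)
  have deriv: "deriv (\<lambda>z. h (\<omega> z)) 0 = deriv h 0 * deriv \<omega> 0"
    by (rule DERIV_imp_deriv[OF DERIV_compose_fixing_0[OF univalent_holomorphic[OF h] \<omega>(1)]])
  fix z :: complex assume z: "z \<in> ball 0 1 - {0}"
  then have "\<omega> z \<in> ball 0 1 - {0}"
    using \<omega>(2) univalent_nonzero[OF \<omega>(1)] by blast
  then have "1 / h (\<omega> z) = 1 / deriv h 0 * (1 / \<omega> z) + v (\<omega> z)"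
    using v by (simp add: is_reciprocal_regular_part_def)
  moreover have "1 / \<omega> z = 1 / deriv \<omega> 0 / z + u z"
    using u z by (simp only: is_reciprocal_regular_part_def)
  ultimately show "1 / h (\<omega> z) = 1 / deriv (\<lambda>z. h (\<omega> z)) 0 / z + (1 / deriv h 0 * u z + v (\<omega> z))"
    by (simp add: deriv algebra_simps)
qed

text \<open>The chain rule for the Schwarzian derivative, \<open>S (h \<circ> \<omega>) = (S h \<circ> \<omega>) * \<omega>'\<^sup>2 + S \<omega>\<close>, at \<open>0\<close>.\<close>

lemma schwarzian_coeff_compose:
  assumes h: "univalent_fixing_0 h" and \<omega>: "univalent_fixing_0 \<omega>" "\<omega> ` ball 0 1 \<subseteq> ball 0 1"
  shows "schwarzian_coeff (\<lambda>z. h (\<omega> z)) = schwarzian_coeff h + schwarzian_coeff \<omega> / (deriv h 0)\<^sup>2"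
proof -
  obtain u v where u: "is_reciprocal_regular_part \<omega> u" and v: "is_reciprocal_regular_part h v"
    using reciprocal_regular_part_exists h \<omega>(1) by metis
  then have u_holo: "u holomorphic_on ball 0 1" and v_holo: "v holomorphic_on ball 0 1"
    by (simp_all add: is_reciprocal_regular_part_def)
  have "deriv (\<lambda>z. h (\<omega> z)) 0 * schwarzian_coeff (\<lambda>z. h (\<omega> z)) =
      deriv (\<lambda>z. 1 / deriv h 0 * u z + v (\<omega> z)) 0"
    by (rule deriv_reciprocal_regular_part[OF univalent_fixing_0_compose[OF h \<omega>]
          reciprocal_regular_part_compose[OF h \<omega> u v], symmetric])
  also have "\<dots> = 1 / deriv h 0 * deriv u 0 + deriv v 0 * deriv \<omega> 0"
    by (intro DERIV_imp_deriv DERIV_add DERIV_cmult DERIV_holomorphic_at_0 DERIV_compose_fixing_0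
        u_holo v_holo \<omega>)
  also have "\<dots> = deriv h 0 * deriv \<omega> 0 * (schwarzian_coeff h + schwarzian_coeff \<omega> / (deriv h 0)\<^sup>2)"
    unfolding deriv_reciprocal_regular_part[OF \<omega>(1) u] deriv_reciprocal_regular_part[OF h v]
    using univalent_deriv_nonzero[OF h] by (simp add: field_simps power2_eq_square)
  also have "deriv (\<lambda>z. h (\<omega> z)) 0 = deriv h 0 * deriv \<omega> 0"
    by (rule DERIV_imp_deriv[OF DERIV_compose_fixing_0[OF univalent_holomorphic[OF h] \<omega>(1)]])
  finally show ?thesis
    using univalent_deriv_nonzero[OF h] univalent_deriv_nonzero[OF \<omega>(1)] by simp
qed

lemma inj_on_Joukowski:
  assumes s: "norm s \<le> 1"
  shows "inj_on (\<lambda>u::complex. 1 / u + s * u) (ball 0 1 - {0})"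
proof (rule inj_onI)
  fix u v :: complex
  assume uv: "u \<in> ball 0 1 - {0}" "v \<in> ball 0 1 - {0}" "1 / u + s * u = 1 / v + s * v"
  have "norm u * norm v < 1"
    using uv mult_strict_mono[of "norm u" 1 "norm v" 1] by simp
  then have "norm (s * u * v) < 1"
    using s mult_mono[of "norm s" 1 "norm u * norm v" "norm u * norm v"]
    by (simp add: norm_mult mult.assoc)
  then have "1 - s * u * v \<noteq> 0" by auto
  moreover have "(v - u) * (1 - s * u * v) = u * v * ((1 / u + s * u) - (1 / v + s * v))"
    using uv by (simp add: field_simps)
  ultimately show "u = v" using uv by simp
qed

lemma univalent_simple_pole_Joukowski:
  assumes \<omega>: "univalent_fixing_0 \<omega>" "\<omega> ` ball 0 1 \<subseteq> ball 0 1"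
    and u: "is_reciprocal_regular_part \<omega> u" and s: "norm s \<le> 1"
  shows "univalent_simple_pole (\<lambda>z. u z + s * \<omega> z) (1 / deriv \<omega> 0)"
proof
  show "(\<lambda>z. u z + s * \<omega> z) holomorphic_on ball 0 1"
    using u univalent_holomorphic[OF \<omega>(1)]
    by (intro holomorphic_intros) (simp_all add: is_reciprocal_regular_part_def)
  have "\<omega> ` (ball 0 1 - {0}) \<subseteq> ball 0 1 - {0}"
    using \<omega>(2) univalent_nonzero[OF \<omega>(1)] by (auto simp: image_subset_iff)
  then have "inj_on ((\<lambda>w. 1 / w + s * w) \<circ> \<omega>) (ball 0 1 - {0})"
    by (intro comp_inj_on inj_on_subset[OF univalent_inj_on[OF \<omega>(1)]]
        inj_on_subset[OF inj_on_Joukowski[OF s]]) auto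
  then show "inj_on (\<lambda>z. 1 / deriv \<omega> 0 / z + (u z + s * \<omega> z)) (ball 0 1 - {0})"
    by (rule inj_on_cong[THEN iffD1, rotated]) (use u in \<open>auto simp: is_reciprocal_regular_part_def\<close>)
qed (simp add: univalent_deriv_nonzero[OF \<omega>(1)])

lemma norm_add_1_le_if_norm_add_le:
  fixes w :: "'a::real_normed_field"
  assumes "\<And>s. norm s \<le> 1 \<Longrightarrow> norm (w + s) \<le> B"
  shows "norm w + 1 \<le> B"
proof (cases "w = 0")
  case False
  have "norm w *\<^sub>R sgn w = w"
    using False by (simp add: sgn_div_norm)
  then have "w + sgn w = (norm w + 1) *\<^sub>R sgn w"
    by (simp add: scaleR_left_distrib)
  then have "norm (w + sgn w) = norm w + 1"
    using False by (simp only: norm_scaleR norm_sgn) simp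
  with assms[of "sgn w"] False show ?thesis by (simp add: norm_sgn)
qed (use assms[of 1] in simp)

lemma norm_schwarzian_coeff_self_map_le:
  assumes \<omega>: "univalent_fixing_0 \<omega>" "\<omega> ` ball 0 1 \<subseteq> ball 0 1"
  shows "norm (schwarzian_coeff \<omega>) + 1 \<le> 1 / (norm (deriv \<omega> 0))\<^sup>2"
proof (rule norm_add_1_le_if_norm_add_le)
  fix s :: complex assume s: "norm s \<le> 1"
  obtain u where u: "is_reciprocal_regular_part \<omega> u"
    using reciprocal_regular_part_exists[OF \<omega>(1)] by blast
  then have u_holo: "u holomorphic_on ball 0 1" by (simp add: is_reciprocal_regular_part_def)
  have "deriv (\<lambda>z. u z + s * \<omega> z) 0 = deriv u 0 + s * deriv \<omega> 0"
    by (intro DERIV_imp_deriv DERIV_add DERIV_cmult DERIV_holomorphic_at_0 u_holo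
        univalent_holomorphic \<omega>)
  also have "\<dots> = deriv \<omega> 0 * (schwarzian_coeff \<omega> + s)"
    by (simp add: deriv_reciprocal_regular_part[OF \<omega>(1) u] algebra_simps)
  finally have "norm (deriv \<omega> 0) * norm (schwarzian_coeff \<omega> + s) \<le> 1 / norm (deriv \<omega> 0)"
    using univalent_simple_pole.norm_deriv_regular_part_le[OF
        univalent_simple_pole_Joukowski[OF \<omega> u s]]
    by (simp only: norm_mult norm_divide norm_one)
  then show "norm (schwarzian_coeff \<omega> + s) \<le> 1 / (norm (deriv \<omega> 0))\<^sup>2"
    using univalent_deriv_nonzero[OF \<omega>(1)] by (simp add: pos_le_divide_eq power2_eq_square mult_ac)
qed

lemma univalent_subordination:
  assumes f: "univalent_fixing_0 f" and h: "univalent_fixing_0 h"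
    and sub: "f ` ball 0 1 \<subseteq> h ` ball 0 1"
  obtains \<omega> where "univalent_fixing_0 \<omega>" "\<omega> ` ball 0 1 \<subseteq> ball 0 1"
    "\<And>z. z \<in> ball 0 1 \<Longrightarrow> f z = h (\<omega> z)"
proof -
  obtain k where k: "k holomorphic_on h ` ball 0 1" "\<And>z. z \<in> ball 0 1 \<Longrightarrow> k (h z) = z"
    using holomorphic_has_inverse[OF univalent_holomorphic[OF h] open_ball univalent_inj_on[OF h]]
    by metis
  define \<omega> where "\<omega> = (\<lambda>z. k (f z))"
  have \<omega>: "\<omega> z \<in> ball 0 1" "f z = h (\<omega> z)" if "z \<in> ball 0 1" for z
  proof -
    have "f z \<in> h ` ball 0 1" using that sub by auto
    then obtain y where "y \<in> ball 0 1" "f z = h y" by auto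
    then show "\<omega> z \<in> ball 0 1" "f z = h (\<omega> z)" using k(2) by (auto simp: \<omega>_def)
  qed
  have "univalent_fixing_0 \<omega>"
    unfolding univalent_fixing_0_def
  proof (intro conjI)
    show "\<omega> holomorphic_on ball 0 1"
      using holomorphic_on_compose_gen[OF univalent_holomorphic[OF f] k(1)] sub
      by (simp add: \<omega>_def o_def image_subset_iff_funcset)
    show "inj_on \<omega> (ball 0 1)"
      by (rule inj_onI) (metis \<omega>(2) univalent_inj_on[OF f] inj_onD)
    show "\<omega> 0 = 0" using k(2)[of 0] by (simp add: \<omega>_def univalent_at_0[OF f] univalent_at_0[OF h])
  qed
  then show ?thesis by (rule that) (use \<omega> in auto)
qed

theorem schwarzian_coeff_subordination:
  assumes f: "univalent_fixing_0 f" and h: "univalent_fixing_0 h"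
    and sub: "f ` ball 0 1 \<subseteq> h ` ball 0 1"
  shows "norm (schwarzian_coeff f - schwarzian_coeff h) \<le>
           1 / (norm (deriv f 0))\<^sup>2 - 1 / (norm (deriv h 0))\<^sup>2"
proof -
  obtain \<omega> where \<omega>: "univalent_fixing_0 \<omega>" "\<omega> ` ball 0 1 \<subseteq> ball 0 1"
    and f_eq: "\<And>z. z \<in> ball 0 1 \<Longrightarrow> f z = h (\<omega> z)"
    using univalent_subordination[OF assms] by blast
  have "eventually (\<lambda>z. f z = h (\<omega> z)) (nhds 0)"
    using f_eq by (intro eventually_nhds_in_open[of "ball 0 1", THEN eventually_mono]) auto
  then have "(deriv ^^ n) f 0 = (deriv ^^ n) (\<lambda>z. h (\<omega> z)) 0" for n
    by (intro higher_deriv_cong_ev) auto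
  then have expansion: "fps_expansion f 0 = fps_expansion (\<lambda>z. h (\<omega> z)) 0"
    by (simp add: fps_expansion_def)
  have "schwarzian_coeff f - schwarzian_coeff h = schwarzian_coeff \<omega> / (deriv h 0)\<^sup>2"
    using schwarzian_coeff_compose[OF h \<omega>] expansion by (simp add: schwarzian_coeff_def)
  also have "norm \<dots> \<le> (1 / (norm (deriv \<omega> 0))\<^sup>2 - 1) / (norm (deriv h 0))\<^sup>2"
    using norm_schwarzian_coeff_self_map_le[OF \<omega>]
    unfolding norm_divide norm_power by (intro divide_right_mono) simp_all
  also have "\<dots> = 1 / (norm (deriv h 0 * deriv \<omega> 0))\<^sup>2 - 1 / (norm (deriv h 0))\<^sup>2"
    by (simp add: norm_mult power_mult_distrib diff_divide_distrib mult.commute)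
  also have "deriv h 0 * deriv \<omega> 0 = deriv f 0"
    using DERIV_imp_deriv[OF DERIV_compose_fixing_0[OF univalent_holomorphic[OF h] \<omega>(1)]] expansion
    by (metis fps_expansion_nth_Suc_0)
  finally show ?thesis .
qed

lemma inverted_exterior_measurable: "inverted_exterior D \<in> sets lebesgue"
proof -
  have "inverted_exterior D = (- {0} \<inter> (\<lambda>w. 1 / w) -` (- closure D)) \<union> {0}"
    by (force simp: inverted_exterior_def)
  moreover have "open (- {0} \<inter> (\<lambda>w::complex. 1 / w) -` (- closure D))"
    by (intro continuous_open_preimage continuous_intros) auto
  ultimately show ?thesis by auto
qed

theorem area_inverted_exterior_le:
  assumes f: "univalent_fixing_0 f"
  shows "measure lebesgue (inverted_exterior (f ` ball 0 1)) / (2 * pi) \<le>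
           1 / (norm (deriv f 0))\<^sup>2 - norm (schwarzian_coeff f)"
proof -
  let ?\<Omega> = "inverted_exterior (f ` ball 0 1)"
  obtain g where g: "is_reciprocal_regular_part f g"
    using reciprocal_regular_part_exists[OF f] by blast
  interpret pole: univalent_simple_pole g "1 / deriv f 0"
    by (rule univalent_simple_pole_reciprocal[OF f g])
  have "pole.G z \<notin> ?\<Omega>" if z: "z \<in> ball 0 1 - {0}" for z
  proof
    assume "pole.G z \<in> ?\<Omega>"
    moreover have "pole.G z = 1 / f z"
      using g z by (simp add: pole.G_def is_reciprocal_regular_part_def)
    ultimately have "f z \<notin> closure (f ` ball 0 1)"
      using univalent_nonzero[OF f z] by (auto simp: inverted_exterior_def)
    moreover have "f z \<in> closure (f ` ball 0 1)"
      using z by (intro closure_subset[THEN subsetD] imageI) simp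
    ultimately show False by contradiction
  qed
  then have "?\<Omega> \<inter> pole.G ` (ball 0 1 - {0}) = {}" by blast
  then have "measure lebesgue ?\<Omega> \<le> pi * ((norm (1 / deriv f 0))\<^sup>2 - (norm (deriv g 0))\<^sup>2)"
    by (rule pole.area_theorem_deriv[OF inverted_exterior_measurable])
  then have "measure lebesgue ?\<Omega> / (2 * pi) \<le> ((norm (1 / deriv f 0))\<^sup>2 - (norm (deriv g 0))\<^sup>2) / 2"
    by (simp add: field_simps)
  also have "\<dots> \<le> (norm (1 / deriv f 0))\<^sup>2 - norm (1 / deriv f 0) * norm (deriv g 0)"
    using sum_squares_bound[of "norm (1 / deriv f 0)" "norm (deriv g 0)"] by simp
  also have "norm (1 / deriv f 0) * norm (deriv g 0) = norm (schwarzian_coeff f)"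
    using univalent_deriv_nonzero[OF f]
    by (simp add: deriv_reciprocal_regular_part[OF f g] norm_mult norm_divide)
  finally show ?thesis by (simp add: norm_divide power_divide)
qed

lemma
  assumes "interior_conformal_map D f"
  shows interior_conformal_map_imp_univalent: "univalent_fixing_0 f"
    and interior_conformal_map_image: "f ` ball 0 1 = D"
    and interior_conformal_map_deriv: "deriv f 0 = of_real (norm (deriv f 0))"
proof -
  show "univalent_fixing_0 f" "f ` ball 0 1 = D"
    using assms by (auto simp: interior_conformal_map_def univalent_fixing_0_def bij_betw_def)
  have "deriv f 0 = of_real (Re (deriv f 0))" "Re (deriv f 0) > 0"
    using assms by (simp_all add: interior_conformal_map_def)
  then show "deriv f 0 = of_real (norm (deriv f 0))" by (metis abs_of_pos norm_of_real)
qed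

lemma fps_expansion_nth_eq_coefficient:
  assumes "\<forall>z\<in>ball 0 1. (\<lambda>n. b (Suc n) * z ^ Suc n) sums f z"
  shows "fps_nth (fps_expansion f 0) (Suc n) = b (Suc n)"
proof -
  define F where "F = Abs_fps (\<lambda>n. if n = 0 then 0 else b n)"
  have "f has_fps_expansion F"
  proof (rule has_fps_expansionI)
    have "(\<lambda>n. fps_nth F n * z ^ n) sums f z" if "z \<in> ball 0 1" for z
      using bspec[OF assms that] sums_Suc_iff[of "\<lambda>n. fps_nth F n * z ^ n"] by (simp add: F_def)
    then show "\<forall>\<^sub>F z in nhds 0. (\<lambda>n. fps_nth F n * z ^ n) sums f z"
      by (intro eventually_nhds_in_open[of "ball 0 1", THEN eventually_mono]) auto
  qed
  from fps_nth_fps_expansion[OF this, of "Suc n"] show ?thesis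
    by (simp add: F_def fps_expansion_def)
qed

lemma coefficient_functional_eq:
  assumes f: "interior_conformal_map D f"
    and sums: "\<forall>z\<in>ball 0 1. (\<lambda>n. b (Suc n) * z ^ Suc n) sums f z"
  shows "1 / Re (b 1) ^ 2 + s * (1 / Re (b 1) ^ 3 * Re (b 2 ^ 2 / b 1 - b 3)) =
           1 / (norm (deriv f 0))\<^sup>2 + s * Re (schwarzian_coeff f)"
proof -
  have coeff: "fps_nth (fps_expansion f 0) (Suc n) = b (Suc n)" for n
    by (rule fps_expansion_nth_eq_coefficient[OF sums])
  define p where "p = norm (deriv f 0)"
  have p: "b 1 = of_real p"
    using coeff[of 0] interior_conformal_map_deriv[OF f] by (simp add: p_def)
  have Re_b1: "Re (b 1) = p" unfolding p by simp
  have "schwarzian_coeff f = (b 2 ^ 2 / b 1 - b 3) / of_real (p ^ 3)"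
    using coeff[of 0] coeff[of 1] coeff[of 2] p
    by (simp add: schwarzian_coeff_def Let_def eval_nat_numeral)
  then have "Re (schwarzian_coeff f) = Re (b 2 ^ 2 / b 1 - b 3) / p ^ 3"
    by (simp only: Re_divide_of_real)
  then show ?thesis by (simp only: Re_b1 flip: p_def) simp
qed

lemma abs_sign_mult_Re_le:
  assumes "s \<in> {1, -1::real}"
  shows "\<bar>s * Re z\<bar> \<le> norm z"
  using assms abs_Re_le_cmod[of z] by auto

theorem theorem5p3:
  fixes Dt :: "complex set" and \<Phi> :: "complex \<Rightarrow> complex" and b :: "nat \<Rightarrow> complex"
    and \<Omega> :: "complex set"
  assumes "enclosed_by_smooth_Jordan_curve Dt" and "0 \<in> Dt"
    and "interior_conformal_map Dt \<Phi>"
    and "\<And>z. z \<in> ball 0 1 \<Longrightarrow> (\<lambda>n. b (Suc n) * z ^ Suc n) sums \<Phi> z"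
    and "\<Omega> = inverted_exterior Dt"
  shows
    "(\<forall>s\<in>{1, -1::real}.
        1 / Re (b 1) ^ 2 + s * (1 / Re (b 1) ^ 3 * Re (b 2 ^ 2 / b 1 - b 3))
          \<ge> measure lebesgue \<Omega> / (2 * pi)) \<and>
     (measure lebesgue \<Omega> = 1 \<longrightarrow>
       (\<forall>s\<in>{1, -1::real}.
          1 / Re (b 1) ^ 2 + s * (1 / Re (b 1) ^ 3 * Re (b 2 ^ 2 / b 1 - b 3))
            \<ge> 1 / (2 * pi))) \<and>
     (\<forall>(Vt :: complex set) (\<Psi> :: complex \<Rightarrow> complex) (c :: nat \<Rightarrow> complex).
        enclosed_by_smooth_Jordan_curve Vt \<and> Dt \<subseteq> Vt \<and>
        interior_conformal_map Vt \<Psi> \<and>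
        (\<forall>z\<in>ball 0 1. (\<lambda>n. c (Suc n) * z ^ Suc n) sums \<Psi> z) \<longrightarrow>
        (\<forall>s\<in>{1, -1::real}.
           1 / Re (b 1) ^ 2 + s * (1 / Re (b 1) ^ 3 * Re (b 2 ^ 2 / b 1 - b 3))
             \<ge> 1 / Re (c 1) ^ 2 + s * (1 / Re (c 1) ^ 3 * Re (c 2 ^ 2 / c 1 - c 3))))"
proof -
  have sums: "\<forall>z\<in>ball 0 1. (\<lambda>n. b (Suc n) * z ^ Suc n) sums \<Phi> z" using assms(4) by blast
  let ?T = "\<lambda>s b. 1 / Re (b 1) ^ 2 + s * (1 / Re (b 1) ^ 3 * Re (b 2 ^ 2 / b 1 - b 3))"
  note univalent = interior_conformal_map_imp_univalent and image = interior_conformal_map_image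
    and functional = coefficient_functional_eq
  have area: "?T s b \<ge> measure lebesgue \<Omega> / (2 * pi)" if "s \<in> {1, -1}" for s
    using area_inverted_exterior_le[OF univalent[OF assms(3)]]
      abs_sign_mult_Re_le[OF that, of "schwarzian_coeff \<Phi>"]
    unfolding functional[OF assms(3) sums] image[OF assms(3)] assms(5) by linarith
  have mono: "?T s b \<ge> ?T s c" if "Dt \<subseteq> Vt" "interior_conformal_map Vt \<Psi>"
      "\<forall>z\<in>ball 0 1. (\<lambda>n. c (Suc n) * z ^ Suc n) sums \<Psi> z" and s: "s \<in> {1, -1}" for Vt \<Psi> c s
    using schwarzian_coeff_subordination[OF univalent[OF assms(3)] univalent[OF that(2)]] that(1)
      abs_sign_mult_Re_le[OF s, of "schwarzian_coeff \<Phi> - schwarzian_coeff \<Psi>"]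
    unfolding functional[OF assms(3) sums] functional[OF that(2,3)]
      image[OF assms(3)] image[OF that(2)] by (simp add: right_diff_distrib)
  show ?thesis
  proof (intro conjI ballI allI impI)
    show "?T s b \<ge> 1 / (2 * pi)" if "measure lebesgue \<Omega> = 1" "s \<in> {1, -1}" for s
      using area[OF that(2)] unfolding that(1) .
  qed (use area mono in blast)+
qed

end
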